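(* Given a set of numbers $a_1,\dots,a_n\ge0$ in a sparse representation (i.e., as the set $S$ of indices $i$ with $a_i>0$ together with their values), there exists a data structure supporting the following queries: (1) sample an index $i\in[n]$ from the distribution $\{a_i/\sum_j a_j\}_i$ in time $O(\log n)$; (2) given $k\ge1$, produce a set $R\subseteq[n]$ that includes each $i$ independently with probability $\min\{k a_i,1\}$, in expected time $O((1+k\sum_{i=1}^n a_i)\log n)$; (3) given an interval $[s,t]\subseteq[n]$ and $k\ge1$, produce a set $R\subseteq[n]$ that includes each $i\in[s,t]$ independently with probability $\min\{k a_i,1\}$, in expected time $O((1+k\sum_{i=s}^t a_i)\log^2 n)$. The preprocessing time is $O(|S|\cdot\log^{O(1)}n)$. *)

theory Defs
  imports "HOL-Probability.Probability"
begin

text \<open>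
  Running times refer to a randomised real RAM with \<^term>\<open>w::nat\<close>-bit words. A program is a
  finite syntactic object working on word registers, real registers, a word memory and a real
  memory, both addressed by words. It performs arithmetic on words modulo \<open>2 ^ w\<close> and exact
  arithmetic on reals. Reals can be compared, and words can be cast to reals, but there is no
  conversion (such as rounding) from reals to words. The only source of randomness is a coin whose
  bias is a computed real; this is no stronger than drawing a uniform real from \<open>[0, 1]\<close> and
  comparing it with the bias.
\<close>

record state =
  wreg :: "nat \<Rightarrow> nat"
  rreg :: "nat \<Rightarrow> real"
  wmem :: "nat \<Rightarrow> nat"
  rmem :: "nat \<Rightarrow> real"

datatype wexp =
    WConst nat
  | WReg nat
  | WLoad wexp
  | WAdd wexp wexp
  | WSub wexp wexp
  | WMul wexp wexp
  | WDiv wexp wexp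
  | WMod wexp wexp

text \<open>Subtraction of words is truncated at zero; the other operations wrap around.\<close>

primrec wval :: "nat \<Rightarrow> wexp \<Rightarrow> state \<Rightarrow> nat" where
  "wval w (WConst m) s = m mod 2 ^ w"
| "wval w (WReg x) s = wreg s x"
| "wval w (WLoad e) s = wmem s (wval w e s)"
| "wval w (WAdd e f) s = (wval w e s + wval w f s) mod 2 ^ w"
| "wval w (WSub e f) s = wval w e s - wval w f s"
| "wval w (WMul e f) s = (wval w e s * wval w f s) mod 2 ^ w"
| "wval w (WDiv e f) s = wval w e s div wval w f s"
| "wval w (WMod e f) s = wval w e s mod wval w f s"

text \<open>
  There are no real constants other than casts of words, so that no information can be hidden in
  the digits of a constant of the program.
\<close>

datatype rexp =
    RCast wexp
  | RReg nat
  | RLoad wexp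
  | RAdd rexp rexp
  | RSub rexp rexp
  | RMul rexp rexp
  | RDiv rexp rexp

primrec rval :: "nat \<Rightarrow> rexp \<Rightarrow> state \<Rightarrow> real" where
  "rval w (RCast e) s = real (wval w e s)"
| "rval w (RReg x) s = rreg s x"
| "rval w (RLoad e) s = rmem s (wval w e s)"
| "rval w (RAdd e f) s = rval w e s + rval w f s"
| "rval w (RSub e f) s = rval w e s - rval w f s"
| "rval w (RMul e f) s = rval w e s * rval w f s"
| "rval w (RDiv e f) s = rval w e s / rval w f s"

datatype bexp =
    WLess wexp wexp
  | RLess rexp rexp
  | BNot bexp
  | BAnd bexp bexp

primrec bval :: "nat \<Rightarrow> bexp \<Rightarrow> state \<Rightarrow> bool" where
  "bval w (WLess e f) s = (wval w e s < wval w f s)"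
| "bval w (RLess e f) s = (rval w e s < rval w f s)"
| "bval w (BNot b) s = (\<not> bval w b s)"
| "bval w (BAnd b c) s = (bval w b s \<and> bval w c s)"

datatype com =
    Skip
  | WAssign nat wexp
  | RAssign nat rexp
  | WStore wexp wexp
  | RStore wexp rexp
  | Flip nat rexp
  | Seq com com
  | If bexp com com
  | While bexp com

text \<open>
  The semantics is a subprobability distribution over pairs of a final state and the time spent;
  the missing mass is the probability of nontermination. Every elementary command and every test
  costs one unit. Expressions contribute only a constant factor, as a program has fixed size.
\<close>

partial_function (spmf) loop ::
  "(state \<Rightarrow> bool) \<Rightarrow> (state \<Rightarrow> (state \<times> nat) spmf) \<Rightarrow> state \<Rightarrow> (state \<times> nat) spmf" where
  "loop b body s =
     (if b s then
        bind_spmf (body s) (\<lambda>(s1, t1).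
        bind_spmf (loop b body s1) (\<lambda>(s2, t2).
        return_spmf (s2, 1 + t1 + t2)))
      else return_spmf (s, 1))"

text \<open>\<^const>\<open>bernoulli_pmf\<close> clamps its argument to the unit interval.\<close>

primrec exec :: "nat \<Rightarrow> com \<Rightarrow> state \<Rightarrow> (state \<times> nat) spmf" where
  "exec w Skip s = return_spmf (s, 1)"
| "exec w (WAssign x e) s = return_spmf (s\<lparr>wreg := (wreg s)(x := wval w e s)\<rparr>, 1)"
| "exec w (RAssign x e) s = return_spmf (s\<lparr>rreg := (rreg s)(x := rval w e s)\<rparr>, 1)"
| "exec w (WStore p e) s = return_spmf (s\<lparr>wmem := (wmem s)(wval w p s := wval w e s)\<rparr>, 1)"
| "exec w (RStore p e) s = return_spmf (s\<lparr>rmem := (rmem s)(wval w p s := rval w e s)\<rparr>, 1)"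
| "exec w (Flip x e) s =
     map_spmf (\<lambda>h. (s\<lparr>wreg := (wreg s)(x := of_bool h mod 2 ^ w)\<rparr>, 1))
       (spmf_of_pmf (bernoulli_pmf (rval w e s)))"
| "exec w (Seq c d) s =
     bind_spmf (exec w c s) (\<lambda>(s1, t1).
     bind_spmf (exec w d s1) (\<lambda>(s2, t2).
     return_spmf (s2, t1 + t2)))"
| "exec w (If b c d) s =
     map_spmf (\<lambda>(s1, t1). (s1, 1 + t1)) (if bval w b s then exec w c s else exec w d s)"
| "exec w (While b c) s = loop (bval w b) (exec w c) s"

definition worst_case_time :: "(state \<times> nat) spmf \<Rightarrow> real \<Rightarrow> bool" where
  "worst_case_time M B \<longleftrightarrow> lossless_spmf M \<and> (\<forall>(s, t) \<in> set_spmf M. real t \<le> B)"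

definition expected_time :: "(state \<times> nat) spmf \<Rightarrow> real \<Rightarrow> bool" where
  "expected_time M B \<longleftrightarrow>
     lossless_spmf M \<and> (\<integral>\<^sup>+ (s, t). ennreal (real t) \<partial>measure_spmf M) \<le> ennreal B"

text \<open>
  The sparse representation is an array, in arbitrary order, of the pairs of an index with positive
  value and its value. The rest of the state is arbitrary: memory is not assumed to be initialised.
\<close>

definition sparse_input :: "nat \<Rightarrow> nat \<Rightarrow> (nat \<Rightarrow> real) \<Rightarrow> state \<Rightarrow> bool" where
  "sparse_input w n a s \<longleftrightarrow>
     (\<forall>x. wreg s x < 2 ^ w) \<and> (\<forall>x. wmem s x < 2 ^ w) \<and>
     wreg s 0 = n \<and>
     (\<exists>xs. distinct xs \<and> set xs = {i \<in> {1..n}. a i > 0} \<and> wreg s 1 = length xs \<and>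
        (\<forall>j < length xs. wmem s j = xs ! j \<and> rmem s j = a (xs ! j)))"

datatype query =
    Sample
  | Subset real
  | Interval nat nat real

text \<open>Sampling an index is meaningful only if not all numbers are zero.\<close>

fun valid_query :: "nat \<Rightarrow> (nat \<Rightarrow> real) \<Rightarrow> query \<Rightarrow> bool" where
  "valid_query n a Sample \<longleftrightarrow> (\<Sum>i = 1..n. a i) > 0"
| "valid_query n a (Subset k) \<longleftrightarrow> k \<ge> 1"
| "valid_query n a (Interval l r k) \<longleftrightarrow> 1 \<le> l \<and> l \<le> r \<and> r \<le> n \<and> k \<ge> 1"

text \<open>
  A data structure consists of one program for preprocessing and one for each kind of query. A query
  runs on the current state after its arguments have been put into registers.
\<close>

record data_structure =
  prep :: com
  sample_prog :: com
  subset_prog :: com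
  interval_prog :: com

fun run_query :: "nat \<Rightarrow> data_structure \<Rightarrow> query \<Rightarrow> state \<Rightarrow> (state \<times> nat) spmf" where
  "run_query w P Sample s = exec w (sample_prog P) s"
| "run_query w P (Subset k) s = exec w (subset_prog P) (s\<lparr>rreg := (rreg s)(0 := k)\<rparr>)"
| "run_query w P (Interval l r k) s =
     exec w (interval_prog P)
       (s\<lparr>wreg := (wreg s)(0 := l, 1 := r), rreg := (rreg s)(0 := k)\<rparr>)"

text \<open>
  All states that can occur after preprocessing and any finite sequence of queries. Guarantees for
  every such state hold conditionally on everything that happened before; in particular, the answers
  to successive queries are independent of each other.
\<close>

inductive_set reachable ::
  "nat \<Rightarrow> data_structure \<Rightarrow> nat \<Rightarrow> (nat \<Rightarrow> real) \<Rightarrow> state \<Rightarrow> state set"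
  for w P n a s0 where
  init: "(s, t) \<in> set_spmf (exec w (prep P) s0) \<Longrightarrow> s \<in> reachable w P n a s0"
| query: "s \<in> reachable w P n a s0 \<Longrightarrow> valid_query n a q \<Longrightarrow>
    (s', t) \<in> set_spmf (run_query w P q s) \<Longrightarrow> s' \<in> reachable w P n a s0"

definition out_index :: "state \<Rightarrow> nat" where
  "out_index s = wreg s 0"

text \<open>A set is returned as an array, given by its start address and its length.\<close>

definition out_array :: "state \<Rightarrow> nat list" where
  "out_array s = map (wmem s) [wreg s 0 ..< wreg s 0 + wreg s 1]"

definition returns_index :: "(state \<times> nat) spmf \<Rightarrow> nat pmf \<Rightarrow> bool" where
  "returns_index M D \<longleftrightarrow> map_spmf (out_index \<circ> fst) M = spmf_of_pmf D"

definition returns_set :: "(state \<times> nat) spmf \<Rightarrow> nat set pmf \<Rightarrow> bool" where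
  "returns_set M D \<longleftrightarrow>
     (\<forall>(s, t) \<in> set_spmf M. distinct (out_array s)) \<and>
     map_spmf (set \<circ> out_array \<circ> fst) M = spmf_of_pmf D"

definition includes_independently :: "nat set pmf \<Rightarrow> nat set \<Rightarrow> (nat \<Rightarrow> real) \<Rightarrow> bool" where
  "includes_independently D I p \<longleftrightarrow>
     (\<forall>R \<in> set_pmf D. R \<subseteq> I) \<and>
     (\<forall>i \<in> I. measure_pmf.prob D {R. i \<in> R} = p i) \<and>
     prob_space.indep_events (measure_pmf D) (\<lambda>i. {R. i \<in> R}) I"

end

(*
  After sorting the support, an interval of indices becomes a range [x, y) of positions, and prefix
  sums give the sum of any range in constant time. An index is sampled by repeatedly halving the
  range, going left with probability proportional to the sum of the left half.

  For subset sampling, a range with sum \<sigma> is visited with probability q = min 1 (k * \<sigma>). A visited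
  range of length one outputs its index. Otherwise its halves, with probabilities p1 and p2, are
  visited with the joint law of two independent coins of bias p1 and p2 conditioned on an event of
  probability q containing "at least one head"; it exists because p1 + p2 - p1 * p2 \<le> q. Hence the
  halves are, unconditionally, visited independently, and by induction so are all indices. On each
  level the expected number of visited ranges is at most k times the total sum.
*)
theory Submission
  imports Defs "HOL-Library.Log_Nat"
begin

section \<open>Reasoning about terminating programs\<close>

text \<open>The exact probability that a range contributes an index is one minus a product of
  factors \<open>1 - k * a i\<close>, and would need a new table for every \<open>k\<close>. The
  cruder q costs one subtraction of prefix sums for any range and any \<open>k\<close>. The price is
  that a visited range may yield nothing; such visits are already counted in the bound per level.
  The indices found below a visited range are in general dependent, because the visit is a
  conditioning. So the induction speaks of the law of "visit with probability q, then descend"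
  (\<open>gated\<close>). Likewise the cost of a range is measured given its visit, as a quotient by
  q; multiplied by q it becomes additive. The program is a loop with an explicit stack in
  uninitialised memory. Three properties of the loop are proved separately: a worst-case invariant
  (\<open>surely\<close>) for termination and memory safety, a conserved law
  (\<open>outcome\<close>) for the distribution, and a decreasing potential
  (\<open>expected_cost\<close>) for the time.\<close>

definition surely :: "(state \<times> nat) spmf \<Rightarrow> (state \<Rightarrow> nat \<Rightarrow> bool) \<Rightarrow> bool" where
  "surely M Q \<longleftrightarrow> lossless_spmf M \<and> (\<forall>(s, t) \<in> set_spmf M. Q s t)"

text \<open>\<open>F s\<close> is read as the law of the eventual answer given the present state
  \<open>s\<close>. A step is correct if it preserves \<open>F\<close> on average, as for a
  martingale.\<close>

definition outcome :: "(state \<times> nat) spmf \<Rightarrow> (state \<Rightarrow> 'b pmf) \<Rightarrow> 'b spmf" where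
  "outcome M F = bind_spmf M (\<lambda>(s, t). spmf_of_pmf (F s))"

text \<open>The function \<open>f\<close> is a potential bounding the time still to come, so this is
  the expected total time from before \<open>M\<close> on.\<close>

definition expected_cost :: "(state \<times> nat) spmf \<Rightarrow> (state \<Rightarrow> ennreal) \<Rightarrow> ennreal" where
  "expected_cost M f = (\<integral>\<^sup>+ (s, t). of_nat t + f s \<partial>measure_spmf M)"

lemma surely_return [simp]: "surely (return_spmf (s, t)) Q \<longleftrightarrow> Q s t"
  by (simp add: surely_def)

lemma surely_mono: "surely M Q \<Longrightarrow> (\<And>s t. Q s t \<Longrightarrow> Q' s t) \<Longrightarrow> surely M Q'"
  by (auto simp: surely_def)

lemma surely_map: "surely M (\<lambda>s t. Q (fst (f (s, t))) (snd (f (s, t)))) \<Longrightarrow> surely (map_spmf f M) Q"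
  by (fastforce simp: surely_def)

lemma surely_bind:
  assumes "surely M Q" "\<And>s t. Q s t \<Longrightarrow> surely (f (s, t)) R"
  shows "surely (bind_spmf M f) R"
  using assms by (fastforce simp: surely_def lossless_bind_spmf set_bind_spmf)

lemma surely_Seq:
  assumes "surely (exec w c s) Q"
    and "\<And>s1 t1. Q s1 t1 \<Longrightarrow> surely (exec w d s1) (\<lambda>s2 t2. R s2 (t1 + t2))"
  shows "surely (exec w (Seq c d) s) R"
proof -
  have "surely (bind_spmf (exec w d s1) (\<lambda>(s2, t2). return_spmf (s2, t1 + t2))) R"
    if "Q s1 t1" for s1 t1
    using assms(2)[OF that] by (rule surely_bind) simp
  then show ?thesis
    unfolding exec.simps by (intro surely_bind[OF assms(1)]) simp
qed

lemma outcome_return [simp]: "outcome (return_spmf (s, t)) F = spmf_of_pmf (F s)"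
  by (simp add: outcome_def)

lemma outcome_cong:
  assumes "surely M Q" "\<And>s t. Q s t \<Longrightarrow> F s = G s"
  shows "outcome M F = outcome M G"
  using assms unfolding outcome_def surely_def by (intro bind_spmf_cong) auto

lemma outcome_Seq:
  assumes "surely (exec w c s) Q"
    and "\<And>s1 t1. Q s1 t1 \<Longrightarrow> outcome (exec w d s1) F = spmf_of_pmf (G s1)"
  shows "outcome (exec w (Seq c d) s) F = outcome (exec w c s) G"
proof -
  have "outcome (exec w (Seq c d) s) F = bind_spmf (exec w c s) (\<lambda>(s1, t1). outcome (exec w d s1) F)"
    by (simp add: outcome_def case_prod_unfold)
  also have "\<dots> = outcome (exec w c s) G"
    unfolding outcome_def[of _ G] using assms unfolding surely_def
    by (intro bind_spmf_cong) auto
  finally show ?thesis .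
qed

lemma expected_cost_return [simp]: "expected_cost (return_spmf (s, t)) f = of_nat t + f s"
  by (simp add: expected_cost_def measure_spmf_return_spmf nn_integral_return)

lemma expected_cost_add:
  assumes "lossless_spmf M"
  shows "expected_cost M (\<lambda>s. c + f s) = c + expected_cost M f"
proof -
  have "expected_cost M (\<lambda>s. c + f s) = (\<integral>\<^sup>+ x. c + (case x of (s, t) \<Rightarrow> of_nat t + f s) \<partial>measure_spmf M)"
    unfolding expected_cost_def by (intro nn_integral_cong) (auto simp: ac_simps)
  also have "\<dots> = c + expected_cost M f"
    unfolding expected_cost_def using assms
    by (subst nn_integral_add) (auto simp: lossless_spmf_def weight_spmf_def measure_spmf.emeasure_eq_measure)
  finally show ?thesis .
qed

lemma nn_integral_bind_spmf:
  "(\<integral>\<^sup>+ x. f x \<partial>measure_spmf (bind_spmf M g)) = (\<integral>\<^sup>+ y. (\<integral>\<^sup>+ x. f x \<partial>measure_spmf (g y)) \<partial>measure_spmf M)"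
  unfolding measure_spmf_bind
  by (subst nn_integral_bind[where B = "count_space UNIV"]) (auto simp: o_def)

text \<open>The constant \<open>c\<close> is 0 for sequential composition and 1, the test, for an
  iteration of a loop.\<close>

lemma expected_cost_bind:
  "expected_cost (bind_spmf M (\<lambda>(s1, t1). bind_spmf (f s1) (\<lambda>(s2, t2). return_spmf (s2, c + t1 + t2)))) g
   = (\<integral>\<^sup>+ (s1, t1). expected_cost (map_spmf (\<lambda>(s2, t2). (s2, c + t1 + t2)) (f s1)) g \<partial>measure_spmf M)"
  unfolding expected_cost_def by (simp add: nn_integral_bind_spmf case_prod_unfold map_spmf_conv_bind_spmf)

lemma expected_cost_map:
  assumes "lossless_spmf M"
  shows "expected_cost (map_spmf (\<lambda>(s, t). (s, c + t)) M) g = of_nat c + expected_cost M g"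
  by (simp add: expected_cost_add[OF assms, symmetric])
     (auto simp: expected_cost_def case_prod_unfold o_def ac_simps)

lemma expected_cost_Seq:
  assumes "surely (exec w c s) Q"
    and "\<And>s1 t1. Q s1 t1 \<Longrightarrow> lossless_spmf (exec w d s1) \<and> expected_cost (exec w d s1) f \<le> g s1"
  shows "expected_cost (exec w (Seq c d) s) f \<le> expected_cost (exec w c s) g"
proof -
  have "expected_cost (exec w (Seq c d) s) f =
     (\<integral>\<^sup>+ (s1, t1). expected_cost (map_spmf (\<lambda>(s2, t2). (s2, t1 + t2)) (exec w d s1)) f \<partial>measure_spmf (exec w c s))"
    using expected_cost_bind[of "exec w c s" "exec w d" 0 f] by simp
  also have "\<dots> \<le> expected_cost (exec w c s) g"
    unfolding expected_cost_def[of _ g] using assms unfolding surely_def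
    by (intro nn_integral_mono_AE)
       (auto simp: AE_measure_spmf_iff expected_cost_map intro!: add_left_mono)
  finally show ?thesis .
qed

section \<open>Loop rules for termination, law and expected cost\<close>

lemma loop_True: "b s \<Longrightarrow> loop b body s =
    bind_spmf (body s) (\<lambda>(s1, t1). bind_spmf (loop b body s1) (\<lambda>(s2, t2). return_spmf (s2, 1 + t1 + t2)))"
  by (subst loop.simps) simp

lemma loop_False: "\<not> b s \<Longrightarrow> loop b body s = return_spmf (s, 1)"
  by (subst loop.simps) simp

text \<open>The measure drops for every outcome of the coins, so the number of iterations is bounded
  in the worst case. An iteration costs \<open>K\<close> and a test; the last summand is the failing
  test.\<close>

lemma surely_loop:
  fixes \<mu> :: "state \<Rightarrow> nat"
  assumes step: "\<And>s. I s \<Longrightarrow> b s \<Longrightarrow> surely (body s) (\<lambda>s' t. I s' \<and> \<mu> s' < \<mu> s \<and> t \<le> K)"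
    and "I s"
  shows "surely (loop b body s) (\<lambda>s' t. I s' \<and> \<not> b s' \<and> t \<le> (K + 1) * \<mu> s + 1)"
  using \<open>I s\<close>
proof (induction "\<mu> s" arbitrary: s rule: less_induct)
  case less
  show ?case
  proof (cases "b s")
    case True
    have "surely (bind_spmf (loop b body s1) (\<lambda>(s2, t2). return_spmf (s2, 1 + t1 + t2)))
        (\<lambda>s' t. I s' \<and> \<not> b s' \<and> t \<le> (K + 1) * \<mu> s + 1)"
      if *: "I s1 \<and> \<mu> s1 < \<mu> s \<and> t1 \<le> K" for s1 t1
    proof -
      have "surely (loop b body s1) (\<lambda>s' t. I s' \<and> \<not> b s' \<and> t \<le> (K + 1) * \<mu> s1 + 1)"
        using less.hyps * by blast
      moreover have "(K + 1) * \<mu> s1 + (K + 1) \<le> (K + 1) * \<mu> s"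
        using * mult_le_mono2[of "Suc (\<mu> s1)" "\<mu> s" "K + 1"] by simp
      ultimately show ?thesis
        using * by (elim surely_bind) auto
    qed
    then show ?thesis
      unfolding loop_True[of b s, OF True]
      by (intro surely_bind[OF step[OF less.prems True]]) simp
  next
    case False
    then show ?thesis using less.prems by (simp add: loop_False)
  qed
qed

text \<open>A law conserved by the body is conserved by the loop; the decreasing measure excludes
  loss of mass by nontermination.\<close>

lemma outcome_loop:
  fixes \<mu> :: "state \<Rightarrow> nat"
  assumes step: "\<And>s. I s \<Longrightarrow> b s \<Longrightarrow> surely (body s) (\<lambda>s' t. I s' \<and> \<mu> s' < \<mu> s)"
    and F: "\<And>s. I s \<Longrightarrow> b s \<Longrightarrow> outcome (body s) F = spmf_of_pmf (F s)"
    and "I s"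
  shows "outcome (loop b body s) F = spmf_of_pmf (F s)"
  using \<open>I s\<close>
proof (induction "\<mu> s" arbitrary: s rule: less_induct)
  case less
  show ?case
  proof (cases "b s")
    case True
    have "outcome (loop b body s) F = bind_spmf (body s) (\<lambda>(s1, t1). outcome (loop b body s1) F)"
      by (simp add: outcome_def loop_True[of b s, OF True] case_prod_unfold)
    also have "\<dots> = outcome (body s) F"
      unfolding outcome_def[of "body s"] using step[OF less.prems True] less.hyps
      by (intro bind_spmf_cong) (auto simp: surely_def)
    finally show ?thesis using F less.prems True by simp
  qed (simp add: loop_False)
qed

text \<open>The potential pays for the test and the body and retains its own expected new value; on
  exit it must still pay for the failing test. The measure supplies losslessness, without which the
  time already spent could not be added to the expectation.\<close>

lemma expected_cost_loop:
  fixes \<mu> :: "state \<Rightarrow> nat" and f :: "state \<Rightarrow> ennreal"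
  assumes step: "\<And>s. I s \<Longrightarrow> b s \<Longrightarrow> surely (body s) (\<lambda>s' t. I s' \<and> \<mu> s' < \<mu> s \<and> t \<le> K)"
    and f: "\<And>s. I s \<Longrightarrow> b s \<Longrightarrow> 1 + expected_cost (body s) f \<le> f s"
    and f0: "\<And>s. I s \<Longrightarrow> \<not> b s \<Longrightarrow> 1 \<le> f s"
    and "I s"
  shows "expected_cost (loop b body s) (\<lambda>_. 0) \<le> f s"
  using \<open>I s\<close>
proof (induction "\<mu> s" arbitrary: s rule: less_induct)
  case less
  show ?case
  proof (cases "b s")
    case True
    have lossless: "lossless_spmf (loop b body s1)" if "I s1" for s1
      using surely_loop[OF step that] by (simp add: surely_def)
    have "expected_cost (loop b body s) (\<lambda>_. 0) =
       (\<integral>\<^sup>+ (s1, t1). expected_cost (map_spmf (\<lambda>(s2, t2). (s2, 1 + t1 + t2)) (loop b body s1)) (\<lambda>_. 0)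
          \<partial>measure_spmf (body s))"
      unfolding loop_True[of b s, OF True] by (rule expected_cost_bind)
    also have "\<dots> \<le> (\<integral>\<^sup>+ (s1, t1). of_nat t1 + (1 + f s1) \<partial>measure_spmf (body s))"
    proof (intro nn_integral_mono_AE)
      have "expected_cost (map_spmf (\<lambda>(s2, t2). (s2, Suc t1 + t2)) (loop b body s1)) (\<lambda>_. 0) \<le> of_nat t1 + (1 + f s1)"
        if "(s1, t1) \<in> set_spmf (body s)" for s1 t1
      proof -
        have "I s1" "\<mu> s1 < \<mu> s"
          using step[OF less.prems True] that by (auto simp: surely_def)
        then have "expected_cost (loop b body s1) (\<lambda>_. 0) \<le> f s1"
          using less.hyps by blast
        then show ?thesis
          unfolding expected_cost_map[OF lossless[OF \<open>I s1\<close>]]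
          by (simp add: ac_simps add_mono)
      qed
      then show "AE x in measure_spmf (body s).
         (case x of (s1, t1) \<Rightarrow> expected_cost (map_spmf (\<lambda>(s2, t2). (s2, 1 + t1 + t2)) (loop b body s1)) (\<lambda>_. 0))
         \<le> (case x of (s1, t1) \<Rightarrow> of_nat t1 + (1 + f s1))"
        by (auto simp: AE_measure_spmf_iff)
    qed
    also have "\<dots> = 1 + expected_cost (body s) f"
      using expected_cost_add[of "body s" 1 f] step[OF less.prems True]
      by (simp add: expected_cost_def surely_def)
    also have "\<dots> \<le> f s" using f less.prems True by blast
    finally show ?thesis .
  qed (use f0 less.prems in \<open>simp add: loop_False\<close>)
qed

section \<open>The subset sampling program\<close>

notation Seq (infixr ";;" 60)

text \<open>
  Let \<open>m\<close> be the size of the support. Word registers 2, 3, 4 hold \<open>m\<close>, \<open>2 * m\<close>, \<open>3 * m\<close>; 5 the height of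
  the stack of visited ranges, 6 the number of emitted indices, 7 and 8 the ends of the current range,
  9 its midpoint, 10 and 11 the coins, 12 and 13 the bounds of a binary search. During preprocessing,
  5 is the current power of two, 6 the end of the buffer and 7 a loop counter.
  The word memory contains the sorted support in \<open>[0, m)\<close>, the answer (during sorting, the buffer) in
  \<open>[m, 2 * m)\<close>, and the left and right ends of the ranges on the stack in \<open>[2 * m, 3 * m)\<close> and
  \<open>[3 * m, 4 * m)\<close>. The real memory contains the prefix sums in \<open>[m, 2 * m]\<close>.
\<close>

definition prefix_sum :: "wexp \<Rightarrow> rexp" where
  "prefix_sum e = RLoad (WAdd (WReg 2) e)"

definition clamp :: "nat \<Rightarrow> com" where
  "clamp i = If (RLess (RCast (WConst 1)) (RReg i)) (RAssign i (RCast (WConst 1))) Skip"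

definition inclusion_prob :: "nat \<Rightarrow> nat \<Rightarrow> nat \<Rightarrow> com" where
  "inclusion_prob i x y =
     RAssign i (RMul (RReg 0) (RSub (prefix_sum (WReg y)) (prefix_sum (WReg x)))) ;; clamp i"

definition push :: "nat \<Rightarrow> nat \<Rightarrow> com" where
  "push x y =
     WStore (WAdd (WReg 3) (WReg 5)) (WReg x) ;;
     WStore (WAdd (WReg 4) (WReg 5)) (WReg y) ;;
     WAssign 5 (WAdd (WReg 5) (WConst 1))"

definition heads :: "nat \<Rightarrow> bexp" where
  "heads b = WLess (WConst 0) (WReg b)"

definition choose_children :: com where
  "choose_children =
     WAssign 9 (WDiv (WAdd (WReg 7) (WReg 8)) (WConst 2)) ;;
     inclusion_prob 1 7 9 ;; inclusion_prob 2 9 8 ;; inclusion_prob 3 7 8 ;;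
     Flip 10 (RDiv (RReg 1) (RReg 3)) ;;
     If (heads 10) (Flip 11 (RReg 2))
       (Flip 11 (RDiv (RMul (RReg 2) (RSub (RCast (WConst 1)) (RReg 1))) (RSub (RReg 3) (RReg 1))))"

text \<open>The right half is pushed first, so the left half ends up on top and the stack lists the
  halves in the order in which \<open>descend\<close> unites them.\<close>

definition push_children :: com where
  "push_children =
     If (heads 11) (push 9 8) Skip ;;
     If (heads 10) (push 7 9) Skip"

definition split_range :: com where
  "split_range = choose_children ;; push_children"

definition emit :: com where
  "emit = WStore (WAdd (WReg 2) (WReg 6)) (WLoad (WReg 7)) ;; WAssign 6 (WAdd (WReg 6) (WConst 1))"

definition visit_step :: com where
  "visit_step =
     WAssign 5 (WSub (WReg 5) (WConst 1)) ;;
     WAssign 7 (WLoad (WAdd (WReg 3) (WReg 5))) ;;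
     WAssign 8 (WLoad (WAdd (WReg 4) (WReg 5))) ;;
     If (WLess (WSub (WReg 8) (WReg 7)) (WConst 2)) emit split_range"

definition start_visit :: com where
  "start_visit =
     WAssign 5 (WConst 0) ;; WAssign 6 (WConst 0) ;; inclusion_prob 3 7 8 ;;
     Flip 10 (RReg 3) ;; If (heads 10) (push 7 8) Skip"

definition visit :: com where
  "visit =
     start_visit ;; While (WLess (WConst 0) (WReg 5)) visit_step ;;
     WAssign 0 (WReg 2) ;; WAssign 1 (WReg 6)"

section \<open>Execution of the parts of a visit\<close>

lemma bind_spmf_bind_pmf: "bind_spmf (bind_pmf p f) g = bind_pmf p (\<lambda>x. bind_spmf (f x) g)"
  by (simp add: bind_spmf_def bind_assoc_pmf)

text \<open>Independent coins of bias \<open>p\<close> and \<open>q\<close> conditioned on an event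
  of probability \<open>r\<close>: if the first shows heads, the event has occurred and the second
  is unaffected; otherwise mass \<open>r - p\<close> remains, of which \<open>q * (1 - p)\<close>
  has the second coin heads. If \<open>r = p\<close>, the first coin shows heads almost
  surely.\<close>

definition coins :: "real \<Rightarrow> real \<Rightarrow> real \<Rightarrow> (bool \<times> bool) pmf" where
  "coins p q r = do {
     h1 \<leftarrow> bernoulli_pmf (p / r);
     h2 \<leftarrow> bernoulli_pmf (if h1 then q else q * (1 - p) / (r - p));
     return_pmf (h1, h2)}"

text \<open>No address up to \<open>4 * m\<close> wraps around, and the summand 2 keeps the constant
  2 of the midpoint from wrapping if \<open>m = 0\<close>. The bound on \<open>n + 1\<close> is for
  the right end of an interval query, which is incremented.\<close>

locale sorted_support =
  fixes w n m :: nat and a :: "nat \<Rightarrow> real" and xs :: "nat list"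
  assumes a_nonneg: "\<And>i. i \<in> {1..n} \<Longrightarrow> 0 \<le> a i"
    and sorted: "sorted_wrt (<) xs" and length_xs: "length xs = m"
    and set_xs: "set xs = {i \<in> {1..n}. a i > 0}"
    and word_size: "4 * m + 2 < 2 ^ w" "n + 1 < 2 ^ w"
begin

definition range_sum :: "nat \<Rightarrow> nat \<Rightarrow> real" where
  "range_sum x y = (\<Sum>j = x..<y. a (xs ! j))"

text \<open>The part of the state that all queries preserve: they store words only from address
  \<open>m\<close> on and never store reals.\<close>

definition ready :: "state \<Rightarrow> bool" where
  "ready s \<longleftrightarrow> wreg s 2 = m \<and> wreg s 3 = 2 * m \<and> wreg s 4 = 3 * m \<and>
     (\<forall>j < m. wmem s j = xs ! j) \<and> (\<forall>j \<le> m. rmem s (m + j) = range_sum 0 j)"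

lemma ready_rreg [simp]: "ready (s\<lparr>rreg := f\<rparr>) = ready s"
  by (simp add: ready_def)

lemma ready_wreg [simp]:
  "ready s \<Longrightarrow> f 2 = wreg s 2 \<Longrightarrow> f 3 = wreg s 3 \<Longrightarrow> f 4 = wreg s 4 \<Longrightarrow> ready (s\<lparr>wreg := f\<rparr>)"
  by (simp add: ready_def)

lemma range_sum_diff: "x \<le> y \<Longrightarrow> range_sum 0 y - range_sum 0 x = range_sum x y"
  by (simp add: range_sum_def sum_diff_nat_ivl)

lemma word_pos [simp]: "0 < w"
  using word_size by (cases w) auto

lemma two_mod_word [simp]: "2 mod 2 ^ w = (2 :: nat)"
  using word_size by (intro mod_less) simp

lemma of_bool_mod [simp]: "of_bool b mod 2 ^ w = (of_bool b :: nat)"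
  by (cases b) auto

lemma exec_inclusion_prob:
  assumes "ready s" "wreg s x \<le> wreg s y" "wreg s y \<le> m" "i \<noteq> 0"
  shows "exec w (inclusion_prob i x y) s =
    return_spmf (s\<lparr>rreg := (rreg s)(i := min 1 (rreg s 0 * range_sum (wreg s x) (wreg s y)))\<rparr>, 3)"
proof -
  have "rmem s ((m + wreg s x) mod 2 ^ w) = range_sum 0 (wreg s x)"
    "rmem s ((m + wreg s y) mod 2 ^ w) = range_sum 0 (wreg s y)"
    using assms word_size by (auto simp: ready_def)
  then show ?thesis
    using assms by (auto simp: inclusion_prob_def clamp_def prefix_sum_def ready_def range_sum_diff)
qed

lemma exec_push:
  assumes "ready s" "wreg s 5 < m"
  shows "exec w (push x y) s = return_spmf
    (s\<lparr>wreg := (wreg s)(5 := wreg s 5 + 1),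
       wmem := (wmem s)(2 * m + wreg s 5 := wreg s x, 3 * m + wreg s 5 := wreg s y)\<rparr>, 3)"
  using assms word_size by (simp add: push_def ready_def)

lemma exec_choose_children:
  assumes "ready s" "wreg s 7 = x" "wreg s 8 = y" "Suc x < y" "y \<le> m"
  defines "z \<equiv> (x + y) div 2"
  defines "hit \<equiv> \<lambda>x y. min 1 (rreg s 0 * range_sum x y)" 
  shows "exec w choose_children s = spmf_of_pmf (map_pmf
    (\<lambda>(h1, h2). (s\<lparr>rreg := (rreg s)(1 := hit x z, 2 := hit z y, 3 := hit x y),
       wreg := (wreg s)(9 := z, 10 := of_bool h1, 11 := of_bool h2)\<rparr>, 13))
    (coins (hit x z) (hit z y) (hit x y)))"
proof -
  have z: "(x + y) mod 2 ^ w div 2 = z" "x \<le> z" "z \<le> y" "z \<le> m"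
    using assms word_size by (auto simp: z_def)
  have hit: "min 1 (rreg s 0 * range_sum u v) = hit u v" for u v
    by (simp add: hit_def)
  have "exec w choose_children s = bernoulli_pmf (hit x z / hit x y) \<bind> (\<lambda>h1.
      bernoulli_pmf (if h1 then hit z y else hit z y * (1 - hit x z) / (hit x y - hit x z)) \<bind> (\<lambda>h2.
      return_spmf (s\<lparr>rreg := (rreg s)(1 := hit x z, 2 := hit z y, 3 := hit x y),
          wreg := (wreg s)(9 := z, 10 := of_bool h1, 11 := of_bool h2)\<rparr>, 13)))"
    unfolding choose_children_def using assms(1-5) z
    apply (simp add: exec_inclusion_prob heads_def hit case_prod_unfold bind_map_pmf bind_spmf_bind_pmf)
    apply (intro bind_pmf_cong refl)
    apply (auto simp: bind_map_pmf map_spmf_conv_bind_spmf bind_spmf_bind_pmf intro!: bind_pmf_cong)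
    done
  also have "\<dots> = spmf_of_pmf (map_pmf
    (\<lambda>(h1, h2). (s\<lparr>rreg := (rreg s)(1 := hit x z, 2 := hit z y, 3 := hit x y),
       wreg := (wreg s)(9 := z, 10 := of_bool h1, 11 := of_bool h2)\<rparr>, 13))
    (coins (hit x z) (hit z y) (hit x y)))"
    by (simp add: coins_def map_bind_pmf spmf_of_pmf_bind)
  finally show ?thesis .
qed

section \<open>The stack of visited ranges\<close>

definition stack :: "state \<Rightarrow> (nat \<times> nat) list" where
  "stack s = rev (map (\<lambda>j. (wmem s (2 * m + j), wmem s (3 * m + j))) [0..<wreg s 5])"

definition emitted :: "state \<Rightarrow> nat list" where
  "emitted s = map (wmem s) [m..<m + wreg s 6]"

text \<open>The two bounds keep the answer and the two halves of the stack in disjoint blocks of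
  memory.\<close>

lemma exec_push_stack:
  assumes "ready s" "wreg s 5 < m" "wreg s 6 \<le> m"
  shows "\<exists>s'. exec w (push x y) s = return_spmf (s', 3) \<and> ready s' \<and>
    stack s' = (wreg s x, wreg s y) # stack s \<and> emitted s' = emitted s \<and>
    rreg s' = rreg s \<and> wreg s' = (wreg s)(5 := wreg s 5 + 1)"
  using assms by (auto simp: exec_push ready_def stack_def emitted_def)

lemma exec_push_children:
  assumes "ready s" "wreg s 5 + 2 \<le> m" "wreg s 6 \<le> m"
  shows "\<exists>s' t. exec w push_children s = return_spmf (s', t) \<and> t \<le> 8 \<and> ready s' \<and>
    emitted s' = emitted s \<and> rreg s' = rreg s \<and>
    stack s' = (if 0 < wreg s 10 then [(wreg s 7, wreg s 9)] else []) @
      (if 0 < wreg s 11 then [(wreg s 9, wreg s 8)] else []) @ stack s"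
proof -
  obtain s1 t1 where 1: "exec w (If (heads 11) (push 9 8) Skip) s = return_spmf (s1, t1)" "t1 \<le> 4"
    "ready s1" "emitted s1 = emitted s" "rreg s1 = rreg s"
    "stack s1 = (if 0 < wreg s 11 then [(wreg s 9, wreg s 8)] else []) @ stack s"
    "wreg s1 = (wreg s)(5 := wreg s1 5)" "wreg s1 5 \<le> wreg s 5 + 1"
  proof (cases "0 < wreg s 11")
    case True
    then show ?thesis
      using assms exec_push_stack[of s 9 8] that by (fastforce simp: heads_def)
  next
    case False
    then show ?thesis using assms by (intro that[of s 2]) (auto simp: heads_def)
  qed
  obtain s2 t2 where 2: "exec w (If (heads 10) (push 7 9) Skip) s1 = return_spmf (s2, t2)" "t2 \<le> 4"
    "ready s2" "emitted s2 = emitted s1" "rreg s2 = rreg s1"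
    "stack s2 = (if 0 < wreg s1 10 then [(wreg s1 7, wreg s1 9)] else []) @ stack s1"
  proof (cases "0 < wreg s1 10")
    case True
    moreover have "wreg s1 6 = wreg s 6" by (subst 1(7)) simp
    ultimately show ?thesis
      using 1 assms exec_push_stack[of s1 7 9] that by (fastforce simp: heads_def)
  next
    case False
    then show ?thesis using 1 by (intro that[of s1 2]) (auto simp: heads_def)
  qed
  have "wreg s1 10 = wreg s 10" "wreg s1 7 = wreg s 7" "wreg s1 9 = wreg s 9"
    by (subst 1(7), simp)+
  moreover have "exec w push_children s = return_spmf (s2, t1 + t2)"
    unfolding push_children_def exec.simps(7) 1(1) by (simp add: 2(1) del: exec.simps)
  ultimately show ?thesis
    using 1(2,4-6) 2(2-) by auto
qed

definition pending :: "(nat \<times> nat) list \<Rightarrow> nat list" where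
  "pending st = concat (map (\<lambda>(x, y). map ((!) xs) [x..<y]) st)"

lemma pending_simps [simp]:
  "pending [] = []" "pending ((x, y) # st) = map ((!) xs) [x..<y] @ pending st"
  by (auto simp: pending_def)

lemma pending_append [simp]: "pending (st @ st') = pending st @ pending st'"
  by (simp add: pending_def)

text \<open>Distinctness of the emitted indices together with those still covered by the stack
  serves twice: it makes the answer duplicate-free and it bounds the memory in use.\<close>

definition visiting :: "state \<Rightarrow> bool" where
  "visiting s \<longleftrightarrow> ready s \<and> (\<forall>(x, y) \<in> set (stack s). x < y \<and> y \<le> m) \<and>
     distinct (emitted s @ pending (stack s)) \<and> set (emitted s) \<subseteq> set xs"

lemma length_pending:
  "(\<forall>(x, y) \<in> set st. x < y) \<Longrightarrow> length st \<le> length (pending st)"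
  by (induction st) auto

text \<open>Emitted and pending indices are distinct elements of \<open>xs\<close>, and each stacked
  range covers at least one of them. Hence neither the answer nor the stack can overflow its block
  of length \<open>m\<close>.\<close>

lemma visiting_bounds:
  assumes "visiting s"
  shows "wreg s 6 + length (pending (stack s)) \<le> m" "wreg s 5 \<le> length (pending (stack s))"
proof -
  have "set (pending (stack s)) \<subseteq> set xs"
    using assms length_xs by (auto simp: visiting_def pending_def)
  then have "card (set (emitted s @ pending (stack s))) \<le> card (set xs)"
    using assms by (intro card_mono) (auto simp: visiting_def)
  also have "\<dots> \<le> m" using length_xs card_length by blast
  finally have "card (set (emitted s @ pending (stack s))) \<le> m" .
  moreover have "distinct (emitted s @ pending (stack s))" using assms by (simp add: visiting_def)
  ultimately have "length (emitted s @ pending (stack s)) \<le> m"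
    using distinct_card by metis
  then show "wreg s 6 + length (pending (stack s)) \<le> m" by (simp add: emitted_def)
  have "length (stack s) \<le> length (pending (stack s))"
    using assms by (intro length_pending) (auto simp: visiting_def)
  then show "wreg s 5 \<le> length (pending (stack s))" by (simp add: stack_def)
qed

lemma stack_pop:
  assumes "stack s = (x, y) # st"
  shows "wreg s 5 > 0" "wmem s (2 * m + (wreg s 5 - 1)) = x" "wmem s (3 * m + (wreg s 5 - 1)) = y"
    "rev (map (\<lambda>j. (wmem s (2 * m + j), wmem s (3 * m + j))) [0..<wreg s 5 - 1]) = st"
  using assms by (cases "wreg s 5"; simp add: stack_def)+

lemma exec_visit_step:
  assumes "visiting s" "stack s = (x, y) # st"
  defines "s1 \<equiv> s\<lparr>wreg := (wreg s)(5 := wreg s 5 - 1, 7 := x, 8 := y)\<rparr>"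
  shows "exec w visit_step s = map_spmf (\<lambda>(s2, t2). (s2, 4 + t2))
      (exec w (if y \<le> Suc x then emit else split_range) s1)"
    "ready s1" "stack s1 = st" "emitted s1 = emitted s"
proof -
  have r: "ready s" using assms by (simp add: visiting_def)
  then show "ready s1" by (simp add: s1_def)
  show "stack s1 = st" using stack_pop[OF assms(2)] by (simp add: s1_def stack_def)
  show "emitted s1 = emitted s" by (simp add: s1_def emitted_def)
  have "wreg s 5 \<le> m" using visiting_bounds[OF assms(1)] by simp
  moreover have "wmem s ((2 * m + (wreg s 5 - 1)) mod 2 ^ w) = x" "wmem s ((3 * m + (wreg s 5 - 1)) mod 2 ^ w) = y"
    using stack_pop[OF assms(2)] calculation word_size by simp_all
  moreover have "x < y" using assms by (auto simp: visiting_def)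
  ultimately have "exec w visit_step s = map_spmf (\<lambda>(s2, t2). (s2, Suc (Suc (Suc (Suc t2)))))
      (exec w (if y \<le> Suc x then emit else split_range) s1)"
    using r by (auto simp: visit_step_def ready_def s1_def map_spmf_conv_bind_spmf case_prod_unfold)
  then show "exec w visit_step s = map_spmf (\<lambda>(s2, t2). (s2, 4 + t2))
      (exec w (if y \<le> Suc x then emit else split_range) s1)"
    by (simp add: numeral_eq_Suc)
qed

lemma visit_step_emit:
  assumes "visiting s" "stack s = (x, y) # st" "y \<le> Suc x"
  shows "\<exists>s'. exec w visit_step s = return_spmf (s', 6) \<and> visiting s' \<and> rreg s' = rreg s \<and>
    stack s' = st \<and> emitted s' = emitted s @ [xs ! x] \<and> y = Suc x"
proof -
  define s1 where "s1 = s\<lparr>wreg := (wreg s)(5 := wreg s 5 - 1, 7 := x, 8 := y)\<rparr>"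
  note 1 = exec_visit_step[OF assms(1,2), folded s1_def]
  have y: "y = Suc x" "x < m" using assms by (auto simp: visiting_def)
  have b: "wreg s 6 < m" "wreg s 5 \<le> m"
    using visiting_bounds[OF assms(1)] assms(2) y by auto
  define s2 where "s2 = s1\<lparr>wmem := (wmem s1)(m + wreg s 6 := xs ! x), wreg := (wreg s1)(6 := wreg s 6 + 1)\<rparr>"
  have "wreg s1 6 = wreg s 6" "wreg s1 7 = x" by (simp_all add: s1_def)
  then have "exec w emit s1 = return_spmf (s2, 2)"
    using 1(2) b y word_size by (simp add: emit_def ready_def s2_def)
  then have "exec w visit_step s = return_spmf (s2, 6)"
    using 1(1) y by simp
  moreover have s2: "ready s2" "emitted s2 = emitted s @ [xs ! x]" "rreg s2 = rreg s"
    using 1(2) 1(4) by (auto simp: s2_def ready_def emitted_def s1_def)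
  moreover have "stack s2 = stack s1"
    using b by (auto simp: stack_def s2_def s1_def)
  moreover have "visiting s2"
    using assms s2 1(3) calculation y length_xs by (auto simp: visiting_def)
  ultimately show ?thesis using y 1(3) by auto
qed

lemma visit_step_split:
  assumes "visiting s" "stack s = (x, y) # st" "Suc x < y"
  defines "z \<equiv> (x + y) div 2"
  defines "hit \<equiv> \<lambda>x y. min 1 (rreg s 0 * range_sum x y)"
  shows "\<exists>f. exec w visit_step s = spmf_of_pmf (map_pmf f (coins (hit x z) (hit z y) (hit x y))) \<and>
    (\<forall>h1 h2. case f (h1, h2) of (s', t) \<Rightarrow> visiting s' \<and> t \<le> 25 \<and> rreg s' 0 = rreg s 0 \<and>
      emitted s' = emitted s \<and>
      stack s' = (if h1 then [(x, z)] else []) @ (if h2 then [(z, y)] else []) @ st)"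
proof -
  define s1 where "s1 = s\<lparr>wreg := (wreg s)(5 := wreg s 5 - 1, 7 := x, 8 := y)\<rparr>"
  note 1 = exec_visit_step[OF assms(1,2), folded s1_def]
  have y: "y \<le> m" using assms by (auto simp: visiting_def)
  \<comment> \<open>The range on top covers at least two indices, so there is room for one more
    range than before: one is popped, up to two are pushed.\<close>
  have "length (stack s) + 1 \<le> length (pending (stack s))"
  proof -
    have "length st \<le> length (pending st)"
      using assms(1,2) by (intro length_pending) (auto simp: visiting_def)
    then show ?thesis using assms(2,3) by simp
  qed
  then have b: "wreg s1 6 \<le> m" "wreg s1 5 + 2 \<le> m"
    using visiting_bounds[OF assms(1)] stack_pop[OF assms(2)] by (auto simp: s1_def stack_def)
  define s2 where "s2 = (\<lambda>h1 h2. s1\<lparr>rreg := (rreg s1)(1 := hit x z, 2 := hit z y, 3 := hit x y),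
       wreg := (wreg s1)(9 := z, 10 := of_bool h1, 11 := of_bool h2)\<rparr>)"
  have choose: "exec w choose_children s1 = spmf_of_pmf (map_pmf
    (\<lambda>(h1, h2). (s2 h1 h2, 13)) (coins (hit x z) (hit z y) (hit x y)))"
    unfolding s2_def z_def hit_def
    using exec_choose_children[of s1 x y] 1(2) assms y by (simp add: s1_def)
  have ex: "\<exists>p. exec w push_children (s2 h1 h2) = return_spmf p \<and>
     (case p of (s', t) \<Rightarrow> visiting s' \<and> t \<le> 8 \<and> rreg s' 0 = rreg s 0 \<and> emitted s' = emitted s \<and>
      stack s' = (if h1 then [(x, z)] else []) @ (if h2 then [(z, y)] else []) @ st)" for h1 h2
  proof -
    have r: "ready (s2 h1 h2)"
      using 1(2) by (simp add: s2_def)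
    have "wreg (s2 h1 h2) 5 + 2 \<le> m" "wreg (s2 h1 h2) 6 \<le> m"
      "emitted (s2 h1 h2) = emitted s" "stack (s2 h1 h2) = st" "rreg (s2 h1 h2) 0 = rreg s 0"
      "wreg (s2 h1 h2) 7 = x" "wreg (s2 h1 h2) 8 = y" "wreg (s2 h1 h2) 9 = z"
      "wreg (s2 h1 h2) 10 = of_bool h1" "wreg (s2 h1 h2) 11 = of_bool h2"
      using 1 b by (auto simp: s2_def s1_def stack_def emitted_def)
    note s2 = r this
    obtain s' t where s': "exec w push_children (s2 h1 h2) = return_spmf (s', t)" "t \<le> 8"
      "ready s'" "emitted s' = emitted s" "rreg s' 0 = rreg s 0"
      "stack s' = (if h1 then [(x, z)] else []) @ (if h2 then [(z, y)] else []) @ st"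
      using exec_push_children[OF s2(1-3)] s2(4-) by auto
    have "x \<le> z" "z \<le> y"
      using assms(3) by (auto simp: z_def)
    then have "[x..<y] = [x..<z] @ [z..<y]"
      by (metis le_add_diff_inverse upt_add_eq_append)
    then have "visiting s'"
      using assms(1-3) s' y unfolding visiting_def by (auto simp: z_def)
    then show ?thesis
      using s' by auto
  qed
  \<comment> \<open>Pushing is deterministic, so its result is a function of the coins and the whole
    step is an image of the law \<open>coins\<close>.\<close>
  define g where "g = (\<lambda>h1 h2. THE p. exec w push_children (s2 h1 h2) = return_spmf p)"
  have g: "exec w push_children (s2 h1 h2) = return_spmf (g h1 h2) \<and>
     (case g h1 h2 of (s', t) \<Rightarrow> visiting s' \<and> t \<le> 8 \<and> rreg s' 0 = rreg s 0 \<and> emitted s' = emitted s \<and>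
      stack s' = (if h1 then [(x, z)] else []) @ (if h2 then [(z, y)] else []) @ st)" for h1 h2
  proof -
    obtain p where p: "exec w push_children (s2 h1 h2) = return_spmf p"
     "case p of (s', t) \<Rightarrow> visiting s' \<and> t \<le> 8 \<and> rreg s' 0 = rreg s 0 \<and> emitted s' = emitted s \<and>
      stack s' = (if h1 then [(x, z)] else []) @ (if h2 then [(z, y)] else []) @ st"
      using ex by blast
    then have "g h1 h2 = p" by (simp add: g_def)
    then show ?thesis using p by simp
  qed
  have "exec w visit_step s = spmf_of_pmf (map_pmf (\<lambda>(h1, h2). case g h1 h2 of (s', t) \<Rightarrow> (s', 17 + t))
      (coins (hit x z) (hit z y) (hit x y)))"
    unfolding 1(1) using assms(3)
    by (simp add: split_range_def choose g case_prod_unfold map_spmf_conv_bind_spmf bind_spmf_of_pmf bind_map_pmf bind_spmf_bind_pmf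
        spmf_of_pmf_def map_pmf_def bind_assoc_pmf bind_return_pmf)
  moreover have "case (case g h1 h2 of (s', t) \<Rightarrow> (s', 17 + t)) of (s', t) \<Rightarrow> visiting s' \<and> t \<le> 25 \<and>
      rreg s' 0 = rreg s 0 \<and> emitted s' = emitted s \<and>
      stack s' = (if h1 then [(x, z)] else []) @ (if h2 then [(z, y)] else []) @ st" for h1 h2
    using g[of h1 h2] by (simp add: case_prod_unfold)
  ultimately show ?thesis
    by (intro exI[of _ "\<lambda>(h1, h2). case g h1 h2 of (s', t) \<Rightarrow> (s', 17 + t)"]) simp
qed

end

section \<open>Conditioned pairs of coins\<close>

lemma bernoulli_pmf_zero [simp]: "bernoulli_pmf 0 = return_pmf False"
  by (rule pmf_eqI) (auto simp: indicator_def)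

lemma surely_pmf: "surely (spmf_of_pmf (map_pmf f p)) Q \<longleftrightarrow> (\<forall>c \<in> set_pmf p. case f c of (s, t) \<Rightarrow> Q s t)"
  by (auto simp: surely_def)

lemma outcome_pmf: "outcome (spmf_of_pmf (map_pmf f p)) F = spmf_of_pmf (bind_pmf p (\<lambda>c. F (fst (f c))))"
  by (simp add: outcome_def bind_map_pmf spmf_of_pmf_bind case_prod_unfold)

lemma expected_cost_pmf: "expected_cost (spmf_of_pmf (map_pmf f p)) g =
    (\<integral>\<^sup>+ c. of_nat (snd (f c)) + g (fst (f c)) \<partial>measure_pmf p)"
  by (simp add: expected_cost_def case_prod_unfold)

locale coin_probs =
  fixes p q r :: real
  assumes p: "0 \<le> p" "p \<le> 1" and q: "0 \<le> q" "q \<le> 1" and r: "0 < r" "r \<le> 1" "p \<le> r" "p + q - p * q \<le> r"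
begin

lemma cond_prob: "0 \<le> q * (1 - p) / (r - p)" "q * (1 - p) / (r - p) \<le> 1"
proof -
  show "0 \<le> q * (1 - p) / (r - p)" using p q r by (intro divide_nonneg_nonneg) auto
  show "q * (1 - p) / (r - p) \<le> 1" using r by (cases "r = p") (auto simp: divide_le_eq algebra_simps)
qed

text \<open>If \<open>r = p\<close>, the quotient is 0 by convention, and
  \<open>p + q - p * q \<le> r\<close> forces \<open>q * (1 - p) = 0\<close> as well.\<close>

lemma cond_prob_mult: "(r - p) * (q * (1 - p) / (r - p)) = q * (1 - p)"
proof (cases "r = p")
  case True
  then have "q * (1 - p) \<le> 0" using r by (simp add: algebra_simps)
  moreover have "0 \<le> q * (1 - p)" using p q by simp
  ultimately show ?thesis using True by simp
qed simp

text \<open>Used for the law, with indicators, and for the expected cost of a split.\<close>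

lemma nn_integral_coins:
  assumes "\<And>h1 h2. 0 \<le> f (h1, h2)"
  shows "(\<integral>\<^sup>+ c. ennreal (f c) \<partial>coins p q r) = ennreal (
     (p * q * f (True, True) + p * (1 - q) * f (True, False) + q * (1 - p) * f (False, True)
       + (r - p - q * (1 - p)) * f (False, False)) / r)"
proof -
  define c d where "c = q * (1 - p) / (r - p)" and "d = p / r"
  have cd: "0 \<le> c" "c \<le> 1" "0 \<le> d" "d \<le> 1" using p r cond_prob by (auto simp: c_def d_def)
  have "(\<integral>\<^sup>+ c. ennreal (f c) \<partial>coins p q r) = ennreal (
      (f (True, True) * q + f (True, False) * (1 - q)) * d +
      (f (False, True) * c + f (False, False) * (1 - c)) * (1 - d))"
    unfolding coins_def c_def[symmetric] d_def[symmetric]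
    using assms cd q
    by (simp add: nn_integral_bind_pmf nn_integral_return_pmf flip: ennreal_plus ennreal_mult)
  \<comment> \<open>Multiplied out by \<open>r\<close>, the conditional probability occurs only with
    the factor \<open>r - p\<close>, so that \<open>cond_prob_mult\<close> removes the quotient even
    for \<open>r = p\<close>.\<close>
  also have "(f (True, True) * q + f (True, False) * (1 - q)) * d +
      (f (False, True) * c + f (False, False) * (1 - c)) * (1 - d) =
    ((f (True, True) * q + f (True, False) * (1 - q)) * p +
      (f (False, True) * ((r - p) * c) + f (False, False) * ((r - p) - (r - p) * c))) / r"
    using r by (simp add: d_def field_simps)
  finally show ?thesis
    unfolding c_def cond_prob_mult by (simp add: algebra_simps)
qed

lemma pmf_coins:
  "pmf (coins p q r) (h1, h2) =
     (if h1 then p * (if h2 then q else 1 - q)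
      else if h2 then q * (1 - p) else r - p - q * (1 - p)) / r"
proof -
  have "ennreal (pmf (coins p q r) (h1, h2)) = (\<integral>\<^sup>+ c. ennreal (indicat_real {(h1, h2)} c) \<partial>coins p q r)"
    by (simp add: ennreal_indicator emeasure_pmf_single)
  also have "\<dots> = ennreal ((if h1 then p * (if h2 then q else 1 - q)
      else if h2 then q * (1 - p) else r - p - q * (1 - p)) / r)"
    by (subst nn_integral_coins) (auto simp: indicator_def)
  finally show ?thesis
    using p q r mult_left_le_one_le[of q p] by (subst (asm) ennreal_inj) (auto intro!: divide_nonneg_nonneg simp: algebra_simps)
qed

text \<open>The factor \<open>r\<close> cancels the denominator. Both tails receive the mass
  \<open>1 - r\<close> of the missed event in addition to \<open>r - p - q * (1 - p)\<close>, which
  makes \<open>(1 - p) * (1 - q)\<close>.\<close>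

lemma coins_independent:
  "bind_pmf (bernoulli_pmf r) (\<lambda>b. if b then coins p q r else return_pmf (False, False)) =
     pair_pmf (bernoulli_pmf p) (bernoulli_pmf q)"
proof (rule pmf_eqI)
  fix h :: "bool \<times> bool"
  obtain h1 h2 where h: "h = (h1, h2)" by fastforce
  show "pmf (bind_pmf (bernoulli_pmf r) (\<lambda>b. if b then coins p q r else return_pmf (False, False))) h =
     pmf (pair_pmf (bernoulli_pmf p) (bernoulli_pmf q)) h"
    using p q r unfolding h
    by (cases h1; cases h2; simp add: pmf_bind pmf_pair pmf_coins field_simps)
qed

end

section \<open>Random sets with independent membership\<close>

definition union_pmf :: "'a set pmf \<Rightarrow> 'a set pmf \<Rightarrow> 'a set pmf" where
  "union_pmf P Q = bind_pmf P (\<lambda>A. bind_pmf Q (\<lambda>B. return_pmf (A \<union> B)))"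

lemma union_pmf_empty [simp]: "union_pmf (return_pmf {}) P = P" "union_pmf P (return_pmf {}) = P"
  by (simp_all add: union_pmf_def bind_return_pmf bind_return_pmf')

lemma union_pmf_assoc: "union_pmf (union_pmf P Q) R = union_pmf P (union_pmf Q R)"
  by (simp add: union_pmf_def bind_assoc_pmf bind_return_pmf Un_assoc)

definition gated :: "real \<Rightarrow> 'a set pmf \<Rightarrow> 'a set pmf" where
  "gated p P = bind_pmf (bernoulli_pmf p) (\<lambda>b. if b then P else return_pmf {})"

lemma (in coin_probs) gated_coins:
  "gated r (bind_pmf (coins p q r) (\<lambda>(h1, h2).
      union_pmf (if h1 then P else return_pmf {}) (if h2 then Q else return_pmf {}))) =
   union_pmf (gated p P) (gated q Q)"
proof -
  have "gated r (bind_pmf (coins p q r) (\<lambda>(h1, h2).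
      union_pmf (if h1 then P else return_pmf {}) (if h2 then Q else return_pmf {}))) =
    bind_pmf (bind_pmf (bernoulli_pmf r) (\<lambda>b. if b then coins p q r else return_pmf (False, False)))
     (\<lambda>(h1, h2). union_pmf (if h1 then P else return_pmf {}) (if h2 then Q else return_pmf {}))"
    unfolding gated_def bind_assoc_pmf by (intro bind_pmf_cong) (auto simp: bind_return_pmf)
  also have "\<dots> = bind_pmf (bernoulli_pmf p) (\<lambda>h1. bind_pmf (bernoulli_pmf q) (\<lambda>h2.
     union_pmf (if h1 then P else return_pmf {}) (if h2 then Q else return_pmf {})))"
    unfolding coins_independent by (simp add: pair_pmf_def bind_assoc_pmf bind_return_pmf)
  also have "\<dots> = union_pmf (gated p P) (gated q Q)"
    unfolding gated_def union_pmf_def bind_assoc_pmf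
    by (intro bind_pmf_cong refl bind_commute_pmf)
  finally show ?thesis .
qed

definition bernoulli_set :: "'a set \<Rightarrow> ('a \<Rightarrow> real) \<Rightarrow> 'a set pmf" where
  "bernoulli_set A p = map_pmf Collect (Pi_pmf A False (\<lambda>i. bernoulli_pmf (p i)))"

lemma bernoulli_set_empty [simp]: "bernoulli_set {} p = return_pmf {}"
  by (simp add: bernoulli_set_def)

lemma bernoulli_set_singleton: "bernoulli_set {i} p = gated (p i) (return_pmf {i})"
  unfolding bernoulli_set_def gated_def Pi_pmf_singleton
  by (auto simp: map_pmf_def bind_assoc_pmf bind_return_pmf intro!: bind_pmf_cong)

lemma bernoulli_set_Un:
  assumes "finite A" "finite B" "A \<inter> B = {}"
  shows "bernoulli_set (A \<union> B) p = union_pmf (bernoulli_set A p) (bernoulli_set B p)"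
proof -
  have "bernoulli_set (A \<union> B) p = map_pmf (\<lambda>(f, g). Collect (\<lambda>i. if i \<in> A then f i else g i))
      (pair_pmf (Pi_pmf A False (\<lambda>i. bernoulli_pmf (p i))) (Pi_pmf B False (\<lambda>i. bernoulli_pmf (p i))))"
    by (simp add: bernoulli_set_def Pi_pmf_union[OF assms] pmf.map_comp o_def case_prod_unfold)
  also have "\<dots> = map_pmf (\<lambda>(f, g). Collect f \<union> Collect g)
      (pair_pmf (Pi_pmf A False (\<lambda>i. bernoulli_pmf (p i))) (Pi_pmf B False (\<lambda>i. bernoulli_pmf (p i))))"
  proof (intro map_pmf_cong refl, clarsimp)
    fix f g
    assume "f \<in> set_pmf (Pi_pmf A False (\<lambda>i. bernoulli_pmf (p i)))"
      "g \<in> set_pmf (Pi_pmf B False (\<lambda>i. bernoulli_pmf (p i)))"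
    \<comment> \<open>Outside its index set each function takes the default value
      \<open>False\<close>, so combining the functions amounts to uniting the sets.\<close>
    then have "\<forall>i. i \<notin> A \<longrightarrow> \<not> f i" "\<forall>i. i \<notin> B \<longrightarrow> \<not> g i"
      using set_Pi_pmf_subset[OF assms(1), of False] set_Pi_pmf_subset[OF assms(2), of False] by fastforce+
    then show "{i. (i \<in> A \<longrightarrow> f i) \<and> (i \<notin> A \<longrightarrow> g i)} = Collect f \<union> Collect g"
      using assms(3) by auto
  qed
  also have "\<dots> = union_pmf (bernoulli_set A p) (bernoulli_set B p)"
    by (simp add: union_pmf_def bernoulli_set_def pair_pmf_def map_pmf_def bind_assoc_pmf bind_return_pmf)
  finally show ?thesis .
qed

text \<open>A coin of bias 0 always shows the default \<open>False\<close>. This passes from the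
  support to the whole interval of a query.\<close>

lemma bernoulli_set_subset:
  assumes "finite B" "A \<subseteq> B" "\<And>i. i \<in> B - A \<Longrightarrow> p i = 0"
  shows "bernoulli_set A p = bernoulli_set B p"
  using Pi_pmf_subset'[OF assms(1,2), of "\<lambda>i. bernoulli_pmf (p i)" False] assms(3)
  by (simp add: bernoulli_set_def)

lemma includes_independently_bernoulli_set:
  assumes "finite A" "\<And>i. i \<in> A \<Longrightarrow> 0 \<le> p i \<and> p i \<le> 1"
  shows "includes_independently (bernoulli_set A p) A p"
proof -
  let ?P = "Pi_pmf A False (\<lambda>i. bernoulli_pmf (p i))"
  have sub: "\<forall>R \<in> set_pmf (bernoulli_set A p). R \<subseteq> A"
    using set_Pi_pmf_subset[OF assms(1), of False "\<lambda>i. bernoulli_pmf (p i)"]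
    by (auto simp: bernoulli_set_def)
  \<comment> \<open>Singletons \<open>J\<close> give the marginals, arbitrary \<open>J\<close> the
    product rule for independence.\<close>
  have prob: "measure_pmf.prob (bernoulli_set A p) {R. J \<subseteq> R} = (\<Prod>i\<in>J. p i)" if "J \<subseteq> A" for J
  proof -
    have "measure_pmf.prob (bernoulli_set A p) {R. J \<subseteq> R} =
        measure_pmf.prob ?P (Pi A (\<lambda>i. if i \<in> J then {True} else UNIV))"
      using that by (auto simp: bernoulli_set_def Pi_iff intro!: arg_cong[where f = "measure_pmf.prob ?P"] split: if_splits)
    also have "\<dots> = (\<Prod>i\<in>A. if i \<in> J then p i else 1)"
      using assms that by (subst measure_Pi_pmf_Pi) (auto intro!: prod.cong simp: measure_pmf_single)
    also have "\<dots> = (\<Prod>i\<in>J. p i)"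
      using assms(1) that by (simp add: prod.inter_restrict[symmetric] Int_absorb1)
    finally show ?thesis .
  qed
  have "measure_pmf.prob (bernoulli_set A p) {R. i \<in> R} = p i" if "i \<in> A" for i
    using prob[of "{i}"] that by simp
  moreover have "prob_space.indep_events (measure_pmf (bernoulli_set A p)) (\<lambda>i. {R. i \<in> R}) A"
    unfolding prob_space.indep_events_def[OF measure_pmf.prob_space_axioms]
  proof (intro conjI allI impI)
    fix J assume J: "J \<subseteq> A" "finite J" "J \<noteq> {}"
    have "(\<Inter>i\<in>J. {R. i \<in> R}) = {R. J \<subseteq> R}" by auto
    then show "measure_pmf.prob (bernoulli_set A p) (\<Inter>i\<in>J. {R. i \<in> R}) =
        (\<Prod>i\<in>J. measure_pmf.prob (bernoulli_set A p) {R. i \<in> R})"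
      using prob[OF J(1)] calculation J by (auto intro!: prod.cong)
  qed auto
  ultimately show ?thesis
    using sub by (simp add: includes_independently_def)
qed

section \<open>Law and cost of a visit\<close>

context sorted_support
begin

definition indices :: "nat \<Rightarrow> nat \<Rightarrow> nat set" where
  "indices x y = (!) xs ` {x..<y}"

definition hit :: "real \<Rightarrow> nat \<Rightarrow> nat \<Rightarrow> real" where
  "hit k x y = min 1 (k * range_sum x y)"

text \<open>The law of the set emitted on behalf of a range that is being visited, freed from stack
  and memory.\<close>

function descend :: "real \<Rightarrow> nat \<Rightarrow> nat \<Rightarrow> nat set pmf" where
  "descend k x y =
     (if y \<le> Suc x then return_pmf {xs ! x}
      else let z = (x + y) div 2 in
        bind_pmf (coins (hit k x z) (hit k z y) (hit k x y)) (\<lambda>(h1, h2).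
          union_pmf (if h1 then descend k x z else return_pmf {})
            (if h2 then descend k z y else return_pmf {})))"
  by auto
termination by (relation "Wellfounded.measure (\<lambda>(k, x, y). y - x)") auto

declare descend.simps [simp del]

lemma a_pos: "x < m \<Longrightarrow> a (xs ! x) > 0"
  using set_xs length_xs nth_mem by blast

lemma range_sum_pos: "x < y \<Longrightarrow> y \<le> m \<Longrightarrow> range_sum x y > 0"
  unfolding range_sum_def by (intro sum_pos) (auto intro: a_pos)

lemma range_sum_split: "x \<le> z \<Longrightarrow> z \<le> y \<Longrightarrow> range_sum x y = range_sum x z + range_sum z y"
  by (simp add: range_sum_def sum.atLeastLessThan_concat)

lemma range_sum_Suc [simp]: "range_sum x (Suc x) = a (xs ! x)"
  by (simp add: range_sum_def)

lemma hit_bounds: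
  assumes "0 < k" "x < y" "y \<le> m"
  shows "0 < hit k x y" "hit k x y \<le> 1" "hit k x y \<le> k * range_sum x y"
  using assms range_sum_pos[OF assms(2,3)] by (auto simp: hit_def)

lemma coin_probs_hit:
  assumes "0 < k" "x < z" "z < y" "y \<le> m"
  shows "coin_probs (hit k x z) (hit k z y) (hit k x y)"
proof
  have xz: "0 < hit k x z" "hit k x z \<le> 1" "hit k x z \<le> k * range_sum x z"
    and zy: "0 < hit k z y" "hit k z y \<le> 1" "hit k z y \<le> k * range_sum z y"
    using hit_bounds assms by auto
  have split: "k * range_sum x y = k * range_sum x z + k * range_sum z y"
    using range_sum_split[of x z y] assms by (simp add: algebra_simps)
  \<comment> \<open>The probability of at least one head has two upper bounds: 1, by this product,
    and the sum of the two biases, at most \<open>k * range_sum x y\<close>. Hence it is at most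
    their minimum.\<close>
  have "0 \<le> (1 - hit k x z) * (1 - hit k z y)"
    using xz zy by simp
  then have "hit k x z + hit k z y - hit k x z * hit k z y \<le> 1"
    by (simp add: algebra_simps)
  moreover have "0 \<le> hit k x z * hit k z y"
    using xz zy by simp
  ultimately show "hit k x z + hit k z y - hit k x z * hit k z y \<le> hit k x y"
    using xz zy split unfolding hit_def[of k x y] by linarith
  show "hit k x z \<le> hit k x y"
    using xz zy split unfolding hit_def[of k x y] by auto
qed (use assms hit_bounds in \<open>auto intro: less_imp_le\<close>)

lemma indices_split:
  assumes "x \<le> z" "z \<le> y" "y \<le> m"
  shows "indices x y = indices x z \<union> indices z y" "indices x z \<inter> indices z y = {}"
proof -
  have "{x..<y} = {x..<z} \<union> {z..<y}" using assms by auto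
  then show "indices x y = indices x z \<union> indices z y" by (simp add: indices_def image_Un)
  show "indices x z \<inter> indices z y = {}"
    using assms sorted length_xs
    by (auto simp: indices_def strict_sorted_iff nth_eq_iff_index_eq)
qed

text \<open>At a leaf the gate is the coin of the index itself. Above, \<open>gated_coins\<close>
  trades the gate of a range for independent gates of its halves, to which the induction hypothesis
  applies.\<close>

lemma gated_descend:
  assumes "0 < k" "x < y" "y \<le> m"
  shows "gated (hit k x y) (descend k x y) = bernoulli_set (indices x y) (\<lambda>i. min (k * a i) 1)"
  using assms
proof (induction "y - x" arbitrary: x y rule: less_induct)
  case less
  note 1 = less.prems
  show ?case
  proof (cases "y \<le> Suc x")
    case True
    then have "y = Suc x" using 1 by simp
    then show ?thesis
      by (simp add: indices_def bernoulli_set_singleton descend.simps[of k x "Suc x"] hit_def min.commute)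
  next
    case False
    define z where "z = (x + y) div 2"
    have z: "x < z" "z < y" using False by (auto simp: z_def)
    interpret coin_probs "hit k x z" "hit k z y" "hit k x y"
      using coin_probs_hit 1 z by auto
    have "gated (hit k x y) (descend k x y) =
        union_pmf (gated (hit k x z) (descend k x z)) (gated (hit k z y) (descend k z y))"
      using False by (simp add: descend.simps[of k x y] z_def[symmetric] gated_coins)
    also have "\<dots> = union_pmf (bernoulli_set (indices x z) (\<lambda>i. min (k * a i) 1))
        (bernoulli_set (indices z y) (\<lambda>i. min (k * a i) 1))"
      using less.hyps[of z x] less.hyps[of y z] 1 z by simp
    also have "\<dots> = bernoulli_set (indices x y) (\<lambda>i. min (k * a i) 1)"
      using indices_split[of x z y] 1 z by (subst bernoulli_set_Un[symmetric]) (auto simp: indices_def)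
    finally show ?thesis .
  qed
qed

section \<open>Potential for the expected cost\<close>

definition depth :: "nat \<Rightarrow> nat \<Rightarrow> nat" where
  "depth x y = floorlog 2 (y - x - 1)"

text \<open>With one subtracted from the length, the larger half of a range of length l is measured
  by exactly \<open>(l - 1) div 2\<close>, so the rounding up does no harm and a range of length one
  has depth 0.\<close>

lemma depth_split:
  assumes "Suc x < y"
  defines "z \<equiv> (x + y) div 2"
  shows "depth x z < depth x y" "depth z y < depth x y"
proof -
  have "floorlog 2 (y - x - 1) = floorlog 2 ((y - x - 1) div 2) + 1"
    using assms by (subst compute_floorlog) simp
  moreover have "z - x - 1 \<le> (y - x - 1) div 2" "y - z - 1 \<le> (y - x - 1) div 2"
    using assms by (auto simp: z_def)
  ultimately show "depth x z < depth x y" "depth z y < depth x y"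
    unfolding depth_def using floorlog_mono by (metis less_add_one order_le_less_trans)+
qed

text \<open>A bound on the expected time spent on a visited range; one iteration takes time at most 26.
  Multiplied by the probability \<^term>\<open>hit k x y\<close>
  of the visit, it becomes additive in the sums of the children.\<close>

definition visit_cost :: "real \<Rightarrow> nat \<Rightarrow> nat \<Rightarrow> real" where
  "visit_cost k x y = 26 * (k * range_sum x y) * (1 + depth x y) / hit k x y"

lemma hit_visit_cost:
  assumes "0 < k" "x < y" "y \<le> m"
  shows "hit k x y * visit_cost k x y = 26 * (k * range_sum x y) * (1 + depth x y)"
  using hit_bounds[OF assms] by (simp add: visit_cost_def)

lemma visit_cost_ge:
  assumes "0 < k" "x < y" "y \<le> m"
  shows "26 \<le> visit_cost k x y"
proof -
  have "26 * hit k x y * 1 \<le> 26 * (k * range_sum x y) * (1 + depth x y)"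
    using hit_bounds[OF assms] by (intro mult_mono) auto
  then show ?thesis
    using hit_bounds[OF assms] by (simp add: visit_cost_def le_divide_eq)
qed

text \<open>After multiplication by \<open>hit k x y\<close>, the cost of this iteration is at most
  \<open>26 * (k * range_sum x y)\<close>. This is one level of the bound, and both halves have a
  level less to pay for.\<close>

lemma visit_cost_split:
  assumes "0 < k" "Suc x < y" "y \<le> m"
  defines "z \<equiv> (x + y) div 2"
  shows "26 + (hit k x z * visit_cost k x z + hit k z y * visit_cost k z y) / hit k x y \<le> visit_cost k x y"
proof -
  have z: "x < z" "z < y" using assms by (auto simp: z_def)
  have h: "0 < hit k x y" "hit k x y \<le> k * range_sum x y" using hit_bounds assms by auto
  have pos: "0 \<le> k * range_sum x z" "0 \<le> k * range_sum z y"
    using range_sum_pos[of x z] range_sum_pos[of z y] assms(1,3) z by auto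
  have d: "1 + real (depth x z) \<le> depth x y" "1 + real (depth z y) \<le> depth x y"
    using depth_split[OF assms(2)] by (auto simp: z_def)
  have "26 * hit k x y + (hit k x z * visit_cost k x z + hit k z y * visit_cost k z y) =
      26 * hit k x y + (26 * (k * range_sum x z) * (1 + depth x z) + 26 * (k * range_sum z y) * (1 + depth z y))"
    using hit_visit_cost[of k x z] hit_visit_cost[of k z y] assms(1,3) z by simp
  also have "\<dots> \<le> 26 * (k * range_sum x y) + (26 * (k * range_sum x z) * depth x y + 26 * (k * range_sum z y) * depth x y)"
    using h pos d by (intro add_mono mult_left_mono) auto
  also have "\<dots> = 26 * (k * range_sum x y) * (1 + depth x y)"
    using range_sum_split[of x z y] z by (simp add: algebra_simps)
  finally have "(26 * hit k x y + (hit k x z * visit_cost k x z + hit k z y * visit_cost k z y)) / hit k x y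
      \<le> visit_cost k x y"
    unfolding visit_cost_def[of k x y] using h by (intro divide_right_mono) auto
  then show ?thesis
    using h by (simp add: add_divide_distrib)
qed

text \<open>The summand 1 is reserved for the failing test at the end of the loop.\<close>

definition stack_cost :: "real \<Rightarrow> (nat \<times> nat) list \<Rightarrow> real" where
  "stack_cost k st = 1 + (\<Sum>(x, y)\<leftarrow>st. visit_cost k x y)"

lemma stack_cost_ge:
  assumes "0 < k" "\<forall>(x, y) \<in> set st. x < y \<and> y \<le> m"
  shows "1 \<le> stack_cost k st"
proof -
  have "0 \<le> (case p of (x, y) \<Rightarrow> visit_cost k x y)" if "p \<in> set st" for p
    using visit_cost_ge[of k "fst p" "snd p"] assms that by (cases p) fastforce
  then show ?thesis by (auto simp: stack_cost_def intro!: sum_list_nonneg)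
qed

definition stack_pmf :: "real \<Rightarrow> (nat \<times> nat) list \<Rightarrow> nat set pmf" where
  "stack_pmf k st = foldr (\<lambda>(x, y). union_pmf (descend k x y)) st (return_pmf {})"

text \<open>A binary tree with \<open>y - x\<close> leaves has \<open>2 * (y - x) - 1\<close> nodes;
  this counts the iterations left if all coins show heads.\<close>

definition stack_size :: "(nat \<times> nat) list \<Rightarrow> nat" where
  "stack_size st = (\<Sum>(x, y)\<leftarrow>st. 2 * (y - x) - 1)"

lemma stack_nonempty: "bval w (WLess (WConst 0) (WReg 5)) s \<longleftrightarrow> stack s \<noteq> []"
  by (simp add: stack_def)

lemma stack_pmf_Cons: "stack_pmf k ((x, y) # st) = union_pmf (descend k x y) (stack_pmf k st)"
  by (simp add: stack_pmf_def)

lemma union_pmf_bind: "union_pmf (bind_pmf P f) Q = bind_pmf P (\<lambda>c. union_pmf (f c) Q)"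
  by (simp add: union_pmf_def bind_assoc_pmf)

lemma map_insert_union_pmf: "map_pmf ((\<union>) A) P = union_pmf (return_pmf A) P"
  by (simp add: union_pmf_def bind_return_pmf map_pmf_def)

text \<open>The common case distinction of the proofs about termination, law and cost of a step,
  with the machine state reduced to stack, answer and \<open>k\<close>.\<close>

lemma visit_step_cases [consumes 4, case_names emit split]:
  assumes "0 < k" "visiting s" "rreg s 0 = k" "stack s \<noteq> []"
  obtains (emit) x st s' where "x < m" "stack s = (x, Suc x) # st"
      "exec w visit_step s = return_spmf (s', 6)" "visiting s'" "rreg s' 0 = k"
      "stack s' = st" "emitted s' = emitted s @ [xs ! x]"
    | (split) x y z st f where "stack s = (x, y) # st" "Suc x < y" "y \<le> m" "z = (x + y) div 2"
      "x < z" "z < y" "coin_probs (hit k x z) (hit k z y) (hit k x y)"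
      "exec w visit_step s = spmf_of_pmf (map_pmf f (coins (hit k x z) (hit k z y) (hit k x y)))"
      "\<And>h1 h2. visiting (fst (f (h1, h2)))" "\<And>h1 h2. snd (f (h1, h2)) \<le> 25"
      "\<And>h1 h2. rreg (fst (f (h1, h2))) 0 = k" "\<And>h1 h2. emitted (fst (f (h1, h2))) = emitted s"
      "\<And>h1 h2. stack (fst (f (h1, h2))) =
        (if h1 then [(x, z)] else []) @ (if h2 then [(z, y)] else []) @ st"
proof -
  obtain x y st where st: "stack s = (x, y) # st"
    using assms(4) by (metis list.exhaust surj_pair)
  then have xy: "x < y" "y \<le> m" using assms(2) by (auto simp: visiting_def)
  show thesis
  proof (cases "y \<le> Suc x")
    case True
    then obtain s' where "exec w visit_step s = return_spmf (s', 6)" "visiting s'" "rreg s' = rreg s"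
        "stack s' = st" "emitted s' = emitted s @ [xs ! x]" "y = Suc x"
      using visit_step_emit[OF assms(2) st] by blast
    then show ?thesis
      using assms(3) st xy by (intro emit[of x st s']) auto
  next
    case False
    define z where "z = (x + y) div 2"
    have z: "x < z" "z < y" using False by (auto simp: z_def)
    show ?thesis
      using visit_step_split[OF assms(2) st] assms(3) st xy False
      by (auto simp: hit_def[symmetric] z_def[symmetric] case_prod_unfold
          intro: split[OF st _ xy(2) z_def z coin_probs_hit[OF assms(1) z xy(2)]])
  qed
qed

lemma visit_step_surely:
  assumes "0 < k" "visiting s" "rreg s 0 = k" "stack s \<noteq> []"
  shows "surely (exec w visit_step s) (\<lambda>s' t. (visiting s' \<and> rreg s' 0 = k) \<and>
    stack_size (stack s') < stack_size (stack s) \<and> t \<le> 25)"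
  using assms
proof (cases rule: visit_step_cases)
  case (emit x st s')
  then show ?thesis by (simp add: stack_size_def)
next
  case (split x y z st f)
  have "2 * (z - x) - 1 + (2 * (y - z) - 1) < 2 * (y - x) - 1"
    using split(5,6) by linarith
  then have "stack_size (stack (fst (f (h1, h2)))) < stack_size (stack s)" for h1 h2
    using split(1,2,5,6,13) by (auto simp: stack_size_def) arith
  then show ?thesis
    unfolding split(8) surely_pmf using split(9-11) by (auto simp: case_prod_unfold)
qed

text \<open>\<open>F s\<close> is the law of the final answer: the indices already emitted, united
  with independent descents into the stacked ranges. Emitting moves a certain index from the second
  part to the first; splitting unfolds \<open>descend\<close> once.\<close>

lemma visit_step_outcome:
  assumes "0 < k" "visiting s" "rreg s 0 = k" "stack s \<noteq> []"
  defines "F \<equiv> \<lambda>s. map_pmf ((\<union>) (set (emitted s))) (stack_pmf k (stack s))"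
  shows "outcome (exec w visit_step s) F = spmf_of_pmf (F s)"
  using assms(1-4)
proof (cases rule: visit_step_cases)
  case (emit x st s')
  then have "F s = F s'"
    by (simp add: F_def stack_pmf_Cons descend.simps[of k x] map_insert_union_pmf
        union_pmf_assoc[symmetric]) (simp add: union_pmf_def bind_return_pmf)
  then show ?thesis using emit by simp
next
  case (split x y z st f)
  have "F s = bind_pmf (coins (hit k x z) (hit k z y) (hit k x y)) (\<lambda>c. F (fst (f c)))"
    using split(1,2) unfolding F_def
    by (auto simp: stack_pmf_Cons descend.simps[of k x y] split(4)[symmetric] union_pmf_bind map_bind_pmf
        split(12,13) union_pmf_assoc intro!: bind_pmf_cong)
  then show ?thesis
    unfolding split(8) outcome_pmf by simp
qed

lemma visit_step_cost:
  assumes "0 < k" "visiting s" "rreg s 0 = k" "stack s \<noteq> []"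
  defines "c \<equiv> \<lambda>s. ennreal (stack_cost k (stack s))"
  shows "1 + expected_cost (exec w visit_step s) c \<le> c s"
  using assms(1-4)
proof (cases rule: visit_step_cases)
  case (emit x st s')
  have "1 + (6 + stack_cost k st) \<le> stack_cost k (stack s)" "1 \<le> stack_cost k st"
    using visit_cost_ge[of k x "Suc x"] stack_cost_ge[of k st] assms emit
    by (auto simp: stack_cost_def visiting_def)
  then show ?thesis
    using emit by (simp add: c_def flip: ennreal_1 ennreal_plus ennreal_numeral)
next
  case (split x y z st f)
  interpret coin_probs "hit k x z" "hit k z y" "hit k x y" by fact
  let ?l = "visit_cost k x z" and ?r = "visit_cost k z y"
  have nonneg: "1 \<le> stack_cost k st" "26 \<le> ?l" "26 \<le> ?r"
    using visit_cost_ge[of k x z] visit_cost_ge[of k z y] stack_cost_ge[of k st] assms split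
    by (auto simp: visiting_def)
  have "expected_cost (exec w visit_step s) c \<le>
     (\<integral>\<^sup>+ h. ennreal (25 + stack_cost k st + of_bool (fst h) * ?l + of_bool (snd h) * ?r)
        \<partial>coins (hit k x z) (hit k z y) (hit k x y))"
    unfolding split(8) expected_cost_pmf
  proof (intro nn_integral_mono)
    fix h :: "bool \<times> bool"
    obtain h1 h2 where h: "h = (h1, h2)" by fastforce
    have "of_nat (snd (f h)) + c (fst (f h)) = ennreal (snd (f h) + stack_cost k (stack (fst (f h))))"
      using nonneg stack_cost_ge[of k "stack (fst (f h))"] assms(1) split(9) h
      by (subst ennreal_plus) (auto simp: c_def visiting_def ennreal_of_nat_eq_real_of_nat)
    also have "\<dots> \<le> ennreal (25 + stack_cost k st + of_bool (fst h) * ?l + of_bool (snd h) * ?r)"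
      using split(10)[of h1 h2] by (intro ennreal_leI) (auto simp: h split(13) stack_cost_def)
    finally show "of_nat (snd (f h)) + c (fst (f h)) \<le> \<dots>" .
  qed
  \<comment> \<open>The integrand is affine in the two coins, so only their marginals
    \<open>p / r\<close> and \<open>(p * q + q * (1 - p)) / r = q / r\<close> enter.\<close>
  also have "\<dots> = ennreal (25 + stack_cost k st + (hit k x z * ?l + hit k z y * ?r) / hit k x y)"
    using nonneg r by (subst nn_integral_coins) (auto simp: field_simps)
  finally have "1 + expected_cost (exec w visit_step s) c \<le>
      1 + ennreal (25 + stack_cost k st + (hit k x z * ?l + hit k z y * ?r) / hit k x y)"
    by (rule add_left_mono)
  also have "\<dots> = ennreal (stack_cost k st + (26 + (hit k x z * ?l + hit k z y * ?r) / hit k x y))"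
    using nonneg p q r by (simp flip: ennreal_1 ennreal_plus)
  also have "\<dots> \<le> c s"
    using visit_cost_split[of k x y] assms(1) split
    by (auto simp: c_def stack_cost_def intro!: ennreal_leI)
  finally show ?thesis .
qed

lemma out_array_eq:
  assumes "ready s"
  shows "exec w (WAssign 0 (WReg 2) ;; WAssign 1 (WReg 6)) s =
      return_spmf (s\<lparr>wreg := (wreg s)(0 := m, 1 := wreg s 6)\<rparr>, 2)"
    "out_array (s\<lparr>wreg := (wreg s)(0 := m, 1 := wreg s 6)\<rparr>) = emitted s"
    "ready (s\<lparr>wreg := (wreg s)(0 := m, 1 := wreg s 6)\<rparr>)"
  using assms by (simp_all add: ready_def out_array_def emitted_def)

text \<open>Heads with \<open>x = y\<close> would push an empty range and break the invariant. As
  \<open>hit k x x = 0\<close>, this case has probability zero and is excluded by the premise on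
  \<open>h\<close>.\<close>

lemma exec_start_visit:
  assumes "ready s" "wreg s 7 = x" "wreg s 8 = y" "x \<le> y" "y \<le> m" "rreg s 0 = k"
  shows "\<exists>f. exec w start_visit s = spmf_of_pmf (map_pmf f (bernoulli_pmf (hit k x y))) \<and>
    (\<forall>h. (h \<longrightarrow> x < y) \<longrightarrow> (case f h of (s', t) \<Rightarrow> visiting s' \<and> t \<le> 11 \<and> rreg s' 0 = k \<and>
      emitted s' = [] \<and> stack s' = (if h then [(x, y)] else [])))"
proof -
  define s1 where "s1 = (\<lambda>h. s\<lparr>rreg := (rreg s)(3 := hit k x y), wreg := (wreg s)(5 := 0, 6 := 0, 10 := of_bool h)\<rparr>)"
  define c where "c = If (heads 10) (push 7 8) Skip"
  define f where "f = (\<lambda>h. THE p. map_spmf (\<lambda>(s2, t2). (s2, 6 + t2)) (exec w c (s1 h)) = return_spmf p)"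
  have s1: "ready (s1 h)" "wreg (s1 h) 5 = 0" "wreg (s1 h) 6 = 0" "wreg (s1 h) 7 = x" "wreg (s1 h) 8 = y"
    "wreg (s1 h) 10 = of_bool h" "stack (s1 h) = []" "emitted (s1 h) = []" "rreg (s1 h) 0 = k" for h
    using assms by (auto simp: s1_def stack_def emitted_def)
  have ex: "\<exists>s' t. exec w c (s1 h) = return_spmf (s', t) \<and> t \<le> 5 \<and> ready s' \<and> rreg s' 0 = k \<and>
      emitted s' = [] \<and> stack s' = (if h then [(x, y)] else [])" if "h \<longrightarrow> x < y" for h
    using exec_push_stack[OF s1(1), of h 7 8] s1[of h] that assms
    by (cases h) (auto simp: c_def heads_def)
  have f: "map_spmf (\<lambda>(s2, t2). (s2, 6 + t2)) (exec w c (s1 h)) = return_spmf (f h)" for h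
  proof -
    obtain p where "exec w c (s1 h) = return_spmf p"
      by (cases h) (simp_all add: c_def heads_def push_def s1_def)
    then show ?thesis by (simp add: f_def)
  qed
  have "exec w start_visit s = bind_pmf (bernoulli_pmf (hit k x y))
      (\<lambda>h. map_spmf (\<lambda>(s2, t2). (s2, 6 + t2)) (exec w c (s1 h)))"
    unfolding start_visit_def c_def[symmetric]
    using assms by (simp add: exec_inclusion_prob s1_def hit_def case_prod_unfold bind_map_pmf
        bind_spmf_bind_pmf map_spmf_conv_bind_spmf)
  then have "exec w start_visit s = spmf_of_pmf (map_pmf f (bernoulli_pmf (hit k x y)))"
    by (simp add: f bind_pmf_return_spmf)
  moreover have "case f h of (s', t) \<Rightarrow> visiting s' \<and> t \<le> 11 \<and> rreg s' 0 = k \<and>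
      emitted s' = [] \<and> stack s' = (if h then [(x, y)] else [])" if h: "h \<longrightarrow> x < y" for h
  proof -
    obtain s' t where s': "exec w c (s1 h) = return_spmf (s', t)" "t \<le> 5" "ready s'" "rreg s' 0 = k"
        "emitted s' = []" "stack s' = (if h then [(x, y)] else [])"
      using ex[OF h] by blast
    have "distinct (map ((!) xs) [x..<y])"
      using sorted assms(5) length_xs
      by (auto simp: strict_sorted_iff distinct_map inj_on_def nth_eq_iff_index_eq)
    then have "visiting s'"
      using s' assms(5) h by (auto simp: visiting_def)
    moreover have "f h = (s', 6 + t)"
      using f[of h] s'(1) by simp
    ultimately show ?thesis using s' by simp
  qed
  ultimately show ?thesis by (intro exI[of _ f]) simp
qed

end

section \<open>The query programs\<close>

definition sample_step :: com where
  "sample_step =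
     WAssign 9 (WDiv (WAdd (WReg 7) (WReg 8)) (WConst 2)) ;;
     Flip 10 (RDiv (RSub (prefix_sum (WReg 9)) (prefix_sum (WReg 7)))
       (RSub (prefix_sum (WReg 8)) (prefix_sum (WReg 7)))) ;;
     If (heads 10) (WAssign 8 (WReg 9)) (WAssign 7 (WReg 9))"

definition sample_com :: com where
  "sample_com =
     WAssign 7 (WConst 0) ;; WAssign 8 (WReg 2) ;;
     While (WLess (WConst 1) (WSub (WReg 8) (WReg 7))) sample_step ;;
     WAssign 0 (WLoad (WReg 7))"

definition search_step :: "nat \<Rightarrow> com" where
  "search_step e =
     WAssign 9 (WDiv (WAdd (WReg 12) (WReg 13)) (WConst 2)) ;;
     If (WLess (WLoad (WReg 9)) (WReg e)) (WAssign 12 (WAdd (WReg 9) (WConst 1))) (WAssign 13 (WReg 9))"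

definition search :: "nat \<Rightarrow> com" where
  "search e =
     WAssign 12 (WConst 0) ;; WAssign 13 (WReg 2) ;;
     While (WLess (WReg 12) (WReg 13)) (search_step e)"

definition subset_com :: com where
  "subset_com = WAssign 7 (WConst 0) ;; WAssign 8 (WReg 2) ;; visit"

text \<open>A search finds the first position whose index is at least the given bound. Searching for
  the right bound plus one yields the exclusive end of the range of positions.\<close>

definition locate :: com where
  "locate =
     search 0 ;; WAssign 7 (WReg 12) ;; WAssign 1 (WAdd (WReg 1) (WConst 1)) ;;
     search 1 ;; WAssign 8 (WReg 12)"

definition interval_com :: com where
  "interval_com = locate ;; visit"

lemma nn_integral_bernoulli_pmf_real:
  assumes "0 \<le> p" "p \<le> 1" "0 \<le> f True" "0 \<le> f False"
  shows "(\<integral>\<^sup>+ h. ennreal (f h) \<partial>bernoulli_pmf p) = ennreal (f True * p + f False * (1 - p))"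
  using assms by (simp flip: ennreal_plus ennreal_mult)

section \<open>A complete visit\<close>

context sorted_support
begin

lemma exec_While: "exec w (While b c) s = loop (bval w b) (exec w c) s"
  by simp

lemma hit_refl [simp]: "hit k x x = 0"
  by (simp add: hit_def range_sum_def)

context
  fixes k :: real and s :: state and x y :: nat
  assumes k: "0 < k" "rreg s 0 = k" and s: "ready s" "wreg s 7 = x" "wreg s 8 = y" and xy: "x \<le> y" "y \<le> m"
begin

lemma set_pmf_hit: "h \<in> set_pmf (bernoulli_pmf (hit k x y)) \<Longrightarrow> h \<Longrightarrow> x < y"
  using xy by (cases "x = y") auto

lemma start_visit_cases:
  obtains f where "exec w start_visit s = spmf_of_pmf (map_pmf f (bernoulli_pmf (hit k x y)))"
    "\<And>h. h \<in> set_pmf (bernoulli_pmf (hit k x y)) \<Longrightarrow>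
      visiting (fst (f h)) \<and> snd (f h) \<le> 11 \<and> rreg (fst (f h)) 0 = k \<and>
      emitted (fst (f h)) = [] \<and> stack (fst (f h)) = (if h then [(x, y)] else [])"
proof -
  obtain f where f: "exec w start_visit s = spmf_of_pmf (map_pmf f (bernoulli_pmf (hit k x y)))"
    "\<And>h. (h \<longrightarrow> x < y) \<Longrightarrow> (case f h of (s', t) \<Rightarrow> visiting s' \<and> t \<le> 11 \<and> rreg s' 0 = k \<and>
      emitted s' = [] \<and> stack s' = (if h then [(x, y)] else []))"
    using exec_start_visit[OF s xy k(2)] by blast
  show thesis
  proof (rule that[OF f(1)])
    fix h assume "h \<in> set_pmf (bernoulli_pmf (hit k x y))"
    then have "h \<longrightarrow> x < y" using set_pmf_hit by blast
    from f(2)[OF this] show "visiting (fst (f h)) \<and> snd (f h) \<le> 11 \<and> rreg (fst (f h)) 0 = k \<and>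
      emitted (fst (f h)) = [] \<and> stack (fst (f h)) = (if h then [(x, y)] else [])"
      by (simp only: case_prod_unfold)
  qed
qed

abbreviation visit_loop :: com where
  "visit_loop \<equiv> While (WLess (WConst 0) (WReg 5)) visit_step"

abbreviation visit_end :: com where
  "visit_end \<equiv> WAssign 0 (WReg 2) ;; WAssign 1 (WReg 6)"

lemma visit_loop_step:
  assumes "visiting s1 \<and> rreg s1 0 = k" "bval w (WLess (WConst 0) (WReg 5)) s1"
  shows "surely (exec w visit_step s1) (\<lambda>s' t. (visiting s' \<and> rreg s' 0 = k) \<and>
    stack_size (stack s') < stack_size (stack s1) \<and> t \<le> 25)"
  using assms visit_step_surely[OF k(1)] unfolding stack_nonempty by blast

lemma visit_loop_surely:
  assumes "visiting s1" "rreg s1 0 = k"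
  shows "surely (exec w visit_loop s1) (\<lambda>s' t. visiting s' \<and> stack s' = [])"
proof -
  have "surely (exec w visit_loop s1) (\<lambda>s' t. (visiting s' \<and> rreg s' 0 = k) \<and>
      \<not> bval w (WLess (WConst 0) (WReg 5)) s' \<and> t \<le> (25 + 1) * stack_size (stack s1) + 1)"
    unfolding exec_While
    by (rule surely_loop[where I = "\<lambda>s. visiting s \<and> rreg s 0 = k", OF visit_loop_step]) (use assms in simp_all)
  then show ?thesis by (rule surely_mono) (auto simp only: stack_nonempty)
qed

lemma start_visit_surely: "surely (exec w start_visit s) (\<lambda>s' t. visiting s' \<and> rreg s' 0 = k)"
  by (rule start_visit_cases) (auto simp: surely_pmf case_prod_unfold)

lemma visit_end_surely:
  assumes "visiting s1" "rreg s1 0 = k"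
  shows "surely (exec w (visit_loop ;; visit_end) s1) (\<lambda>s' t. ready s' \<and> distinct (out_array s'))"
proof (rule surely_Seq[OF visit_loop_surely[OF assms]])
  fix s2 assume "visiting s2 \<and> stack s2 = []"
  then have "ready s2" "distinct (emitted s2)" by (auto simp: visiting_def)
  then show "surely (exec w visit_end s2) (\<lambda>s' t'. ready s' \<and> distinct (out_array s'))"
    using out_array_eq[of s2] by simp
qed

lemma visit_surely: "surely (exec w visit s) (\<lambda>s' t. ready s' \<and> distinct (out_array s'))"
  unfolding visit_def by (rule surely_Seq[OF start_visit_surely]) (use visit_end_surely in blast)

text \<open>The conserved law \<open>F\<close> is evaluated at both ends of the loop: with an empty
  stack it is the answer, and at the start it is a descent or the empty set, according to the coin,
  which is the gate of \<open>gated_descend\<close>.\<close>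

lemma visit_outcome:
  "outcome (exec w visit s) (\<lambda>s. return_pmf (set (out_array s))) =
     spmf_of_pmf (bernoulli_set (indices x y) (\<lambda>i. min (k * a i) 1))"
proof -
  define F where "F = (\<lambda>s. map_pmf ((\<union>) (set (emitted s))) (stack_pmf k (stack s)))"
  have loop: "outcome (exec w (visit_loop ;; visit_end) s1) (\<lambda>s. return_pmf (set (out_array s))) = spmf_of_pmf (F s1)"
    if s1: "visiting s1" "rreg s1 0 = k" for s1
  proof -
    have "outcome (exec w (visit_loop ;; visit_end) s1) (\<lambda>s. return_pmf (set (out_array s))) =
        outcome (exec w visit_loop s1) (\<lambda>s. return_pmf (set (emitted s)))"
    proof (rule outcome_Seq[OF visit_loop_surely[OF s1]])
      fix s2 assume "visiting s2 \<and> stack s2 = []"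
      then have "ready s2" by (simp add: visiting_def)
      then show "outcome (exec w visit_end s2) (\<lambda>s. return_pmf (set (out_array s))) =
          spmf_of_pmf (return_pmf (set (emitted s2)))"
        using out_array_eq[of s2] by (simp del: spmf_of_pmf_return_pmf)
    qed
    also have "\<dots> = outcome (exec w visit_loop s1) F"
      by (rule outcome_cong[OF visit_loop_surely[OF s1]]) (simp add: F_def stack_pmf_def)
    also have "\<dots> = spmf_of_pmf (F s1)"
      unfolding exec_While
    proof (rule outcome_loop[where I = "\<lambda>s. visiting s \<and> rreg s 0 = k" and \<mu> = "\<lambda>s. stack_size (stack s)"])
      fix s assume s: "visiting s \<and> rreg s 0 = k" "bval w (WLess (WConst 0) (WReg 5)) s"
      show "surely (exec w visit_step s) (\<lambda>s' t. (visiting s' \<and> rreg s' 0 = k) \<and>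
          stack_size (stack s') < stack_size (stack s))"
        by (rule surely_mono[OF visit_loop_step[OF s]]) simp
      show "outcome (exec w visit_step s) F = spmf_of_pmf (F s)"
        unfolding F_def using visit_step_outcome[OF k(1)] s unfolding stack_nonempty by blast
    qed (use s1 in simp)
    finally show ?thesis .
  qed
  have "outcome (exec w visit s) (\<lambda>s. return_pmf (set (out_array s))) = outcome (exec w start_visit s) F"
    unfolding visit_def by (rule outcome_Seq[OF start_visit_surely]) (use loop in blast)
  also have "\<dots> = spmf_of_pmf (gated (hit k x y) (descend k x y))"
  proof (rule start_visit_cases)
    fix f assume f: "exec w start_visit s = spmf_of_pmf (map_pmf f (bernoulli_pmf (hit k x y)))"
    "\<And>h. h \<in> set_pmf (bernoulli_pmf (hit k x y)) \<Longrightarrow>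
      visiting (fst (f h)) \<and> snd (f h) \<le> 11 \<and> rreg (fst (f h)) 0 = k \<and>
      emitted (fst (f h)) = [] \<and> stack (fst (f h)) = (if h then [(x, y)] else [])"
    have "F (fst (f h)) = (if h then descend k x y else return_pmf {})"
      if "h \<in> set_pmf (bernoulli_pmf (hit k x y))" for h
      using f(2)[OF that] unfolding F_def map_insert_union_pmf by (cases h) (simp_all add: stack_pmf_def)
    then show ?thesis
      unfolding f(1) outcome_pmf gated_def by (intro arg_cong[where f = spmf_of_pmf] bind_pmf_cong) auto
  qed
  also have "gated (hit k x y) (descend k x y) = bernoulli_set (indices x y) (\<lambda>i. min (k * a i) 1)"
  proof (cases "x = y")
    case True
    then show ?thesis by (simp add: gated_def indices_def bind_return_pmf)
  qed (use gated_descend k xy in auto)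
  finally show ?thesis .
qed

text \<open>The constant 14 consists of 11 for the start, 2 for the final assignments and 1 for the
  failing test. The coin at the start multiplies \<open>visit_cost\<close> by
  \<open>hit k x y\<close>, which cancels its denominator.\<close>

lemma visit_expected_cost:
  "expected_cost (exec w visit s) (\<lambda>_. 0) \<le> ennreal (14 + 26 * (k * range_sum x y) * (1 + depth x y))"
proof -
  define c where "c = (\<lambda>s. ennreal (stack_cost k (stack s)))"
  have loop: "expected_cost (exec w (visit_loop ;; visit_end) s1) (\<lambda>_. 0) \<le> 2 + c s1"
    if s1: "visiting s1" "rreg s1 0 = k" for s1
  proof -
    have "expected_cost (exec w (visit_loop ;; visit_end) s1) (\<lambda>_. 0) \<le> expected_cost (exec w visit_loop s1) (\<lambda>_. 2 + 0)"
    proof (rule expected_cost_Seq[OF visit_loop_surely[OF s1]])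
      fix s2 assume "visiting s2 \<and> stack s2 = []"
      then have "ready s2" by (simp add: visiting_def)
      then show "lossless_spmf (exec w visit_end s2) \<and> expected_cost (exec w visit_end s2) (\<lambda>_. 0) \<le> 2 + 0"
        using out_array_eq[of s2] by simp
    qed
    also have "\<dots> = 2 + expected_cost (exec w visit_loop s1) (\<lambda>_. 0)"
      using visit_loop_surely[OF s1] by (intro expected_cost_add) (simp add: surely_def)
    also have "expected_cost (exec w visit_loop s1) (\<lambda>_. 0) \<le> c s1"
      unfolding exec_While
    proof (rule expected_cost_loop[where I = "\<lambda>s. visiting s \<and> rreg s 0 = k" and \<mu> = "\<lambda>s. stack_size (stack s)" and K = 25])
      fix s assume "visiting s \<and> rreg s 0 = k"
      then show "1 \<le> c s"
        using stack_cost_ge[of k "stack s"] k by (auto simp: c_def visiting_def simp flip: ennreal_1)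
    next
      fix s assume "visiting s \<and> rreg s 0 = k" "bval w (WLess (WConst 0) (WReg 5)) s"
      then show "1 + expected_cost (exec w visit_step s) c \<le> c s"
        unfolding c_def using visit_step_cost[OF k(1)] unfolding stack_nonempty by blast
    qed (use visit_loop_step s1 in blast)+
    finally show ?thesis by simp
  qed
  have "expected_cost (exec w visit s) (\<lambda>_. 0) \<le> expected_cost (exec w start_visit s) (\<lambda>s. 2 + c s)"
    unfolding visit_def
    by (rule expected_cost_Seq[OF start_visit_surely]) (use loop visit_end_surely in \<open>auto simp: surely_def\<close>)
  also have "\<dots> \<le> (\<integral>\<^sup>+ h. ennreal (14 + of_bool h * visit_cost k x y) \<partial>bernoulli_pmf (hit k x y))"
  proof (rule start_visit_cases)
    fix f assume f: "exec w start_visit s = spmf_of_pmf (map_pmf f (bernoulli_pmf (hit k x y)))"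
    "\<And>h. h \<in> set_pmf (bernoulli_pmf (hit k x y)) \<Longrightarrow>
      visiting (fst (f h)) \<and> snd (f h) \<le> 11 \<and> rreg (fst (f h)) 0 = k \<and>
      emitted (fst (f h)) = [] \<and> stack (fst (f h)) = (if h then [(x, y)] else [])"
    have "of_nat (snd (f h)) + (2 + c (fst (f h))) \<le> ennreal (14 + of_bool h * visit_cost k x y)"
      if h: "h \<in> set_pmf (bernoulli_pmf (hit k x y))" for h
    proof -
      have "0 \<le> stack_cost k (stack (fst (f h)))"
        using stack_cost_ge[of k "stack (fst (f h))"] k f(2)[OF h] by (auto simp: visiting_def split: if_splits)
      then have "of_nat (snd (f h)) + (2 + c (fst (f h))) = ennreal (snd (f h) + (2 + stack_cost k (stack (fst (f h)))))"
        by (simp add: c_def ennreal_of_nat_eq_real_of_nat flip: ennreal_plus ennreal_numeral)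
      also have "\<dots> \<le> ennreal (14 + of_bool h * visit_cost k x y)"
        using f(2)[OF h] by (intro ennreal_leI) (auto simp: stack_cost_def)
      finally show ?thesis .
    qed
    then show ?thesis
      unfolding f(1) expected_cost_pmf by (intro nn_integral_mono_AE) (simp add: AE_measure_pmf_iff)
  qed
  also have "\<dots> = ennreal (14 + hit k x y * visit_cost k x y)"
  proof (cases "x = y")
    case False
    then show ?thesis
      using hit_bounds[of k x y] visit_cost_ge[of k x y] k xy
      by (subst nn_integral_bernoulli_pmf_real) (auto simp: algebra_simps)
  qed (simp add: nn_integral_return_pmf)
  also have "hit k x y * visit_cost k x y = 26 * (k * range_sum x y) * (1 + depth x y)"
    using hit_visit_cost[of k x y] k xy by (cases "x = y") (auto simp: range_sum_def)
  finally show ?thesis .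
qed

end

end

section \<open>Sampling and binary search\<close>

lemma pmf_bind_bernoulli:
  assumes "0 \<le> p" "p \<le> 1"
  shows "pmf (bind_pmf (bernoulli_pmf p) f) i = p * pmf (f True) i + (1 - p) * pmf (f False) i"
  using assms by (simp add: pmf_bind algebra_simps)

context sorted_support
begin

function pick :: "nat \<Rightarrow> nat \<Rightarrow> nat pmf" where
  "pick x y =
     (if y \<le> Suc x then return_pmf (xs ! x)
      else let z = (x + y) div 2 in
        bind_pmf (bernoulli_pmf (range_sum x z / range_sum x y)) (\<lambda>h. if h then pick x z else pick z y))"
  by auto
termination by (relation "Wellfounded.measure (\<lambda>(x, y). y - x)") auto

declare pick.simps [simp del]

text \<open>Along the path to an index the sums of the intermediate ranges cancel.\<close>

lemma pmf_pick:
  assumes "x < y" "y \<le> m"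
  shows "pmf (pick x y) i = (if i \<in> indices x y then a i / range_sum x y else 0)"
  using assms
proof (induction "y - x" arbitrary: x y rule: less_induct)
  case less
  show ?case
  proof (cases "y \<le> Suc x")
    case True
    then have "y = Suc x" using less by simp
    then show ?thesis
      using a_pos[of x] less.prems by (auto simp: pick.simps[of x "Suc x"] indices_def indicator_def)
  next
    case False
    define z where "z = (x + y) div 2"
    have z: "x < z" "z < y" using False by (auto simp: z_def)
    have pos: "0 < range_sum x z" "0 < range_sum z y" "range_sum x y = range_sum x z + range_sum z y"
      using range_sum_pos[of x z] range_sum_pos[of z y] range_sum_split[of x z y] less.prems z by auto
    have "pmf (pick x y) i = range_sum x z / range_sum x y * pmf (pick x z) i
        + (1 - range_sum x z / range_sum x y) * pmf (pick z y) i"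
      using pos False by (subst pick.simps) (simp add: z_def[symmetric] pmf_bind_bernoulli)
    also have "1 - range_sum x z / range_sum x y = range_sum z y / range_sum x y"
      using pos by (simp add: field_simps)
    finally show ?thesis
      using less.hyps[of z x] less.hyps[of y z] less.prems z pos indices_split[of x z y]
      by auto
  qed
qed

lemma prefix_sum_val:
  assumes "ready s" "wval w e s \<le> m"
  shows "rval w (prefix_sum e) s = range_sum 0 (wval w e s)"
  using assms word_size by (simp add: prefix_sum_def ready_def)

lemma exec_sample_step:
  assumes "ready s" "wreg s 7 = x" "wreg s 8 = y" "Suc x < y" "y \<le> m"
  defines "z \<equiv> (x + y) div 2"
  shows "exec w sample_step s = spmf_of_pmf (map_pmf
     (\<lambda>h. (s\<lparr>wreg := (wreg s)(9 := z, 10 := of_bool h, if h then 8 else 7 := z)\<rparr>, 4))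
     (bernoulli_pmf (range_sum x z / range_sum x y)))"
proof -
  have z: "(x + y) mod 2 ^ w div 2 = z" "x \<le> z" "z \<le> y" "z \<le> m" "x \<le> y" "x \<le> m"
    using assms word_size by (auto simp: z_def)
  define s1 where "s1 = s\<lparr>wreg := (wreg s)(9 := z)\<rparr>"
  have s1: "ready s1" using assms by (simp add: s1_def)
  have bias: "rval w (RDiv (RSub (prefix_sum (WReg 9)) (prefix_sum (WReg 7)))
       (RSub (prefix_sum (WReg 8)) (prefix_sum (WReg 7)))) s1 = range_sum x z / range_sum x y"
    using prefix_sum_val[OF s1] z assms(2-5) by (simp add: s1_def range_sum_diff)
  have mid: "exec w (WAssign 9 (WDiv (WAdd (WReg 7) (WReg 8)) (WConst 2))) s = return_spmf (s1, 1)"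
    using z(1) assms(2,3) by (simp add: s1_def)
  have flip: "exec w (Flip 10 (RDiv (RSub (prefix_sum (WReg 9)) (prefix_sum (WReg 7)))
       (RSub (prefix_sum (WReg 8)) (prefix_sum (WReg 7))))) s1 =
      bind_pmf (bernoulli_pmf (range_sum x z / range_sum x y))
        (\<lambda>h. return_spmf (s1\<lparr>wreg := (wreg s1)(10 := of_bool h)\<rparr>, 1))"
    unfolding exec.simps bias by (simp add: bind_pmf_return_spmf)
  show ?thesis
    apply (simp only: sample_step_def exec.simps(7) mid return_bind_spmf prod.case flip bind_pmf_return_spmf[symmetric] map_pmf_def)
    by (auto simp: bind_spmf_bind_pmf spmf_of_pmf_bind case_prod_unfold heads_def s1_def intro!: bind_pmf_cong)
qed

definition sampling :: "state \<Rightarrow> bool" where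
  "sampling s \<longleftrightarrow> ready s \<and> wreg s 7 < wreg s 8 \<and> wreg s 8 \<le> m"

lemma sample_step_surely:
  assumes "sampling s" "bval w (WLess (WConst 1) (WSub (WReg 8) (WReg 7))) s"
  shows "surely (exec w sample_step s)
    (\<lambda>s' t. sampling s' \<and> depth (wreg s' 7) (wreg s' 8) < depth (wreg s 7) (wreg s 8) \<and> t \<le> 4)"
proof -
  have *: "ready s" "Suc (wreg s 7) < wreg s 8" "wreg s 8 \<le> m" using assms by (auto simp: sampling_def)
  show ?thesis
    unfolding exec_sample_step[OF *(1) refl refl *(2,3)] surely_pmf
    using * depth_split[OF *(2)] by (auto simp: sampling_def)
qed

lemma sample_step_outcome:
  assumes "sampling s" "bval w (WLess (WConst 1) (WSub (WReg 8) (WReg 7))) s"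
  shows "outcome (exec w sample_step s) (\<lambda>s. pick (wreg s 7) (wreg s 8)) = spmf_of_pmf (pick (wreg s 7) (wreg s 8))"
proof -
  have *: "ready s" "Suc (wreg s 7) < wreg s 8" "wreg s 8 \<le> m" using assms by (auto simp: sampling_def)
  show ?thesis
    unfolding exec_sample_step[OF *(1) refl refl *(2,3)] outcome_pmf pick.simps[of "wreg s 7" "wreg s 8"]
    using * by (auto simp: Let_def intro!: arg_cong[where f = spmf_of_pmf] bind_pmf_cong)
qed

abbreviation sample_loop :: com where
  "sample_loop \<equiv> While (WLess (WConst 1) (WSub (WReg 8) (WReg 7))) sample_step"

lemma sample_loop_surely:
  assumes "sampling s"
  shows "surely (exec w sample_loop s) (\<lambda>s' t. sampling s' \<and> wreg s' 8 = Suc (wreg s' 7) \<and>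
     t \<le> 5 * depth (wreg s 7) (wreg s 8) + 1)"
proof -
  have "surely (exec w sample_loop s) (\<lambda>s' t. sampling s' \<and>
      \<not> bval w (WLess (WConst 1) (WSub (WReg 8) (WReg 7))) s' \<and>
      t \<le> (4 + 1) * depth (wreg s 7) (wreg s 8) + 1)"
    unfolding exec_While
    by (rule surely_loop[where I = sampling and \<mu> = "\<lambda>s. depth (wreg s 7) (wreg s 8)", OF sample_step_surely])
       (use assms in simp_all)
  then show ?thesis by (rule surely_mono) (auto simp: sampling_def)
qed

lemma sample_loop_outcome:
  assumes "sampling s"
  shows "outcome (exec w sample_loop s) (\<lambda>s. pick (wreg s 7) (wreg s 8)) = spmf_of_pmf (pick (wreg s 7) (wreg s 8))"
  unfolding exec_While
proof (rule outcome_loop[where I = sampling and \<mu> = "\<lambda>s. depth (wreg s 7) (wreg s 8)"])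
  fix s assume s: "sampling s" "bval w (WLess (WConst 1) (WSub (WReg 8) (WReg 7))) s"
  show "surely (exec w sample_step s)
    (\<lambda>s' t. sampling s' \<and> depth (wreg s' 7) (wreg s' 8) < depth (wreg s 7) (wreg s 8))"
    by (rule surely_mono[OF sample_step_surely[OF s]]) simp
qed (use sample_step_outcome assms in blast)+

lemma exec_start_range:
  "exec w (WAssign 7 (WConst 0) ;; WAssign 8 (WReg 2) ;; c) s =
     map_spmf (\<lambda>(s', t). (s', 2 + t)) (exec w c (s\<lparr>wreg := (wreg s)(7 := 0, 8 := wreg s 2)\<rparr>))"
  by (simp add: map_spmf_conv_bind_spmf case_prod_unfold)

lemma outcome_map: "outcome (map_spmf (\<lambda>(s, t). (s, g t)) M) F = outcome M F"
  by (simp add: outcome_def case_prod_unfold map_spmf_conv_bind_spmf)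

lemma sample_com_correct:
  assumes "ready s" "0 < m"
  shows "surely (exec w sample_com s) (\<lambda>s' t. ready s' \<and> t \<le> 5 * depth 0 m + 4)"
    and "outcome (exec w sample_com s) (\<lambda>s. return_pmf (out_index s)) = spmf_of_pmf (pick 0 m)"
proof -
  define s1 where "s1 = s\<lparr>wreg := (wreg s)(7 := 0, 8 := wreg s 2)\<rparr>"
  have s1: "sampling s1" "wreg s1 7 = 0" "wreg s1 8 = m"
    using assms by (auto simp: s1_def sampling_def) (auto simp: ready_def)
  have last: "exec w (WAssign 0 (WLoad (WReg 7))) s2 = return_spmf (s2\<lparr>wreg := (wreg s2)(0 := xs ! wreg s2 7)\<rparr>, 1)"
    "ready (s2\<lparr>wreg := (wreg s2)(0 := xs ! wreg s2 7)\<rparr>)" if "sampling s2" for s2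
    using that by (auto simp: sampling_def) (auto simp: ready_def)
  have eq: "exec w sample_com s = map_spmf (\<lambda>(s', t). (s', 2 + t)) (exec w (sample_loop ;; WAssign 0 (WLoad (WReg 7))) s1)"
    unfolding sample_com_def exec_start_range s1_def ..
  have "surely (exec w (sample_loop ;; WAssign 0 (WLoad (WReg 7))) s1) (\<lambda>s' t. ready s' \<and> t \<le> 5 * depth 0 m + 2)"
    by (rule surely_Seq[OF sample_loop_surely[OF s1(1)]]) (use last s1 in auto)
  then show "surely (exec w sample_com s) (\<lambda>s' t. ready s' \<and> t \<le> 5 * depth 0 m + 4)"
    unfolding eq by (intro surely_map) (auto elim: surely_mono)
  have "outcome (exec w sample_com s) (\<lambda>s. return_pmf (out_index s)) =
      outcome (exec w sample_loop s1) (\<lambda>s. return_pmf (xs ! wreg s 7))"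
    unfolding eq outcome_map
    by (rule outcome_Seq[OF sample_loop_surely[OF s1(1)]]) (use last in \<open>auto simp: out_index_def\<close>)
  also have "\<dots> = outcome (exec w sample_loop s1) (\<lambda>s. pick (wreg s 7) (wreg s 8))"
    by (rule outcome_cong[OF sample_loop_surely[OF s1(1)]]) (auto simp: pick.simps[of _ "Suc _"])
  also have "\<dots> = spmf_of_pmf (pick 0 m)"
    using sample_loop_outcome[OF s1(1)] s1 by simp
  finally show "outcome (exec w sample_com s) (\<lambda>s. return_pmf (out_index s)) = spmf_of_pmf (pick 0 m)" .
qed

section \<open>Binary search\<close>

definition searching :: "state \<Rightarrow> nat \<Rightarrow> state \<Rightarrow> bool" where
  "searching s0 v s \<longleftrightarrow> s = s0\<lparr>wreg := wreg s\<rparr> \<and> (\<forall>i. i \<notin> {9, 12, 13} \<longrightarrow> wreg s i = wreg s0 i) \<and>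
     wreg s 12 \<le> wreg s 13 \<and> wreg s 13 \<le> m \<and>
     (\<forall>j < wreg s 12. xs ! j < v) \<and> (\<forall>j. wreg s 13 \<le> j \<and> j < m \<longrightarrow> v \<le> xs ! j)"

text \<open>Both remaining intervals have length at most half the old one, rounded down. Unlike in
  \<open>depth\<close>, nothing is subtracted from the length: an interval of length one still
  requires a comparison.\<close>

lemma search_step_surely:
  assumes s0: "ready s0" "e \<notin> {9, 12, 13}"
    and s: "searching s0 (wreg s0 e) s" "bval w (WLess (WReg 12) (WReg 13)) s"
  shows "surely (exec w (search_step e) s) (\<lambda>s' t. searching s0 (wreg s0 e) s' \<and>
     floorlog 2 (wreg s' 13 - wreg s' 12) < floorlog 2 (wreg s 13 - wreg s 12) \<and> t \<le> 3)"
proof -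
  define lo hi where "lo = wreg s 12" and "hi = wreg s 13"
  define z where "z = (lo + hi) div 2"
  have b: "lo < hi" "hi \<le> m" using s by (auto simp: searching_def lo_def hi_def)
  then have z: "(lo + hi) mod 2 ^ w div 2 = z" "lo \<le> z" "z < hi" "z < m" "Suc z mod 2 ^ w = Suc z"
    using word_size by (auto simp: z_def)
  have log: "floorlog 2 (hi - lo) = floorlog 2 ((hi - lo) div 2) + 1"
    using b by (subst compute_floorlog) simp
  have mono: "j \<le> j' \<Longrightarrow> j' < m \<Longrightarrow> xs ! j \<le> xs ! j'" for j j'
    using sorted length_xs by (metis le_eq_less_or_eq sorted_wrt_iff_nth_less)
  have "wmem s = wmem s0"
    using s(1) by (metis searching_def state.select_convs(3) state.surjective state.update_convs(1))
  then have mem: "wmem s z = xs ! z" "wreg s e = wreg s0 e" "\<And>r. s\<lparr>wreg := r\<rparr> = s0\<lparr>wreg := r\<rparr>"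
    using s(1) s0 z by (auto simp: searching_def ready_def) (metis state.surjective state.update_convs(1))
  have exec: "exec w (search_step e) s = return_spmf
      (if xs ! z < wreg s0 e then s\<lparr>wreg := (wreg s)(9 := z, 12 := Suc z)\<rparr>
       else s\<lparr>wreg := (wreg s)(9 := z, 13 := z)\<rparr>, 3)"
    using z mem(1,2) s0(2) by (simp add: search_step_def lo_def[symmetric] hi_def[symmetric])
  show ?thesis
  proof (cases "xs ! z < wreg s0 e")
    case True
    have "hi - Suc z \<le> (hi - lo) div 2" using b by (simp add: z_def)
    then have "floorlog 2 (hi - Suc z) < floorlog 2 (hi - lo)"
      using floorlog_mono[of "hi - Suc z" "(hi - lo) div 2" 2] log by simp
    moreover have "xs ! j < wreg s0 e" if "j < Suc z" for j
      using mono[of j z] that z True by simp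
    then have "searching s0 (wreg s0 e) (s\<lparr>wreg := (wreg s)(9 := z, 12 := Suc z)\<rparr>)"
      using s(1) z mem(3) unfolding searching_def by (simp add: hi_def)
    ultimately show ?thesis
      unfolding exec using True by (simp add: lo_def hi_def)
  next
    case False
    have "z - lo \<le> (hi - lo) div 2" using b by (simp add: z_def)
    then have "floorlog 2 (z - lo) < floorlog 2 (hi - lo)"
      using floorlog_mono[of "z - lo" "(hi - lo) div 2" 2] log by simp
    moreover have "wreg s0 e \<le> xs ! j" if "z \<le> j" "j < m" for j
      using mono[of z j] that z False by simp
    then have "searching s0 (wreg s0 e) (s\<lparr>wreg := (wreg s)(9 := z, 13 := z)\<rparr>)"
      using s(1) z mem(3) unfolding searching_def by (simp add: lo_def)
    ultimately show ?thesis
      unfolding exec using False by (simp add: lo_def hi_def)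
  qed
qed

lemma search_surely:
  assumes "ready s" "e \<notin> {9, 12, 13}"
  shows "surely (exec w (search e) s) (\<lambda>s' t. searching s (wreg s e) s' \<and> wreg s' 13 = wreg s' 12 \<and>
     t \<le> 4 * floorlog 2 m + 3)"
proof -
  define s1 where "s1 = s\<lparr>wreg := (wreg s)(12 := 0, 13 := wreg s 2)\<rparr>"
  have s1: "searching s (wreg s e) s1" "wreg s1 12 = 0" "wreg s1 13 = m"
    using assms(1) by (auto simp: s1_def searching_def ready_def)
  have eq: "exec w (search e) s = map_spmf (\<lambda>(s', t). (s', 2 + t)) (loop (bval w (WLess (WReg 12) (WReg 13))) (exec w (search_step e)) s1)"
    by (simp add: search_def s1_def map_spmf_conv_bind_spmf case_prod_unfold)
  have "surely (loop (bval w (WLess (WReg 12) (WReg 13))) (exec w (search_step e)) s1)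
     (\<lambda>s' t. searching s (wreg s e) s' \<and> \<not> bval w (WLess (WReg 12) (WReg 13)) s' \<and>
        t \<le> (3 + 1) * floorlog 2 (wreg s1 13 - wreg s1 12) + 1)"
    by (rule surely_loop[where I = "searching s (wreg s e)" and \<mu> = "\<lambda>s. floorlog 2 (wreg s 13 - wreg s 12)",
          OF search_step_surely[OF assms]]) (use s1 in auto)
  then show ?thesis
    unfolding eq using s1 by (intro surely_map) (auto simp: searching_def elim!: surely_mono)
qed

end

section \<open>Queries\<close>

lemma outcome_const: "lossless_spmf M \<Longrightarrow> outcome M (\<lambda>_. p) = spmf_of_pmf p"
  by (simp add: outcome_def case_prod_unfold bind_spmf_const lossless_spmf_def)

lemma expected_cost_le:
  assumes "surely M (\<lambda>s t. t \<le> B \<and> f s \<le> c)"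
  shows "expected_cost M f \<le> of_nat B + c"
proof -
  have "expected_cost M f \<le> (\<integral>\<^sup>+ x. of_nat B + c \<partial>measure_spmf M)"
    using assms unfolding expected_cost_def surely_def
    by (intro nn_integral_mono_AE) (auto simp: AE_measure_spmf_iff intro!: add_mono)
  also have "\<dots> = of_nat B + c"
    using assms by (simp add: surely_def lossless_spmf_def weight_spmf_def measure_spmf.emeasure_eq_measure)
  finally show ?thesis .
qed

text \<open>This lets \<open>log 2 (real n + 1)\<close> absorb additive constants.\<close>

lemma log_ge_1: "1 \<le> n \<Longrightarrow> 1 \<le> log 2 (real n + 1)"
  using log_mono[of 2 2 "real n + 1"] by simp

lemma floorlog_le_log:
  assumes "1 \<le> n" "m \<le> n"
  shows "real (floorlog 2 m) \<le> 2 * log 2 (real n + 1)"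
proof (cases "m = 0")
  case True
  then show ?thesis using assms by (simp add: floorlog_def)
next
  case False
  then have "real (floorlog 2 m) \<le> log 2 m + 1"
    by (simp add: floorlog_def)
  moreover have "log 2 m \<le> log 2 (real n + 1)"
    using False assms by (intro log_mono) auto
  ultimately show ?thesis using log_ge_1[OF assms(1)] by linarith
qed

text \<open>Origin of the constant 78: an iteration costs at most 26, and
  \<open>1 + d \<le> 3 * L\<close>.\<close>

lemma mult_depth_le:
  assumes "0 \<le> S" "1 \<le> L" "d \<le> 2 * L"
  shows "26 * S * (1 + d) \<le> 78 * S * (L :: real)"
proof -
  have "26 * S * (1 + d) \<le> 26 * S * (3 * L)" using assms by (intro mult_left_mono) auto
  then show ?thesis by simp
qed

lemma returns_set_iff:
  "returns_set M D \<longleftrightarrow> (\<forall>(s, t) \<in> set_spmf M. distinct (out_array s)) \<and>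
     outcome M (\<lambda>s. return_pmf (set (out_array s))) = spmf_of_pmf D"
  by (simp add: returns_set_def outcome_def map_spmf_conv_bind_spmf case_prod_unfold)

lemma returns_index_iff:
  "returns_index M D \<longleftrightarrow> outcome M (\<lambda>s. return_pmf (out_index s)) = spmf_of_pmf D"
  by (simp add: returns_index_def outcome_def map_spmf_conv_bind_spmf case_prod_unfold)

lemma expected_time_iff:
  "expected_time M B \<longleftrightarrow> lossless_spmf M \<and> expected_cost M (\<lambda>_. 0) \<le> ennreal B"
  by (simp add: expected_time_def expected_cost_def ennreal_of_nat_eq_real_of_nat)

context sorted_support
begin

lemma m_le_n: "m \<le> n"
proof -
  have "distinct xs" using sorted by (simp add: strict_sorted_iff)
  then have "m = card (set xs)" using length_xs distinct_card by metis
  also have "\<dots> \<le> card {1..n}" unfolding set_xs by (intro card_mono) auto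
  finally show ?thesis by simp
qed

lemma range_sum_indices:
  assumes "y \<le> m"
  shows "range_sum x y = sum a (indices x y)"
proof -
  have "inj_on ((!) xs) {x..<y}"
    using assms sorted length_xs by (auto simp: strict_sorted_iff inj_on_def nth_eq_iff_index_eq)
  then show ?thesis by (simp add: range_sum_def indices_def sum.reindex)
qed

lemma indices_all: "indices 0 m = set xs"
  using length_xs by (simp add: indices_def set_conv_nth image_def) (auto simp: atLeast0LessThan)

lemma zero_outside: "i \<in> {1..n} \<Longrightarrow> i \<notin> set xs \<Longrightarrow> a i = 0"
  using a_nonneg[of i] set_xs by auto

lemma sum_support:
  assumes "1 \<le> l" "r \<le> n"
  shows "sum a {i \<in> set xs. l \<le> i \<and> i \<le> r} = sum a {l..r}"
  using assms by (intro sum.mono_neutral_left) (auto intro!: zero_outside)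

lemma bernoulli_set_support:
  assumes "1 \<le> l" "r \<le> n"
  shows "bernoulli_set {i \<in> set xs. l \<le> i \<and> i \<le> r} (\<lambda>i. min (k * a i) 1) =
     bernoulli_set {l..r} (\<lambda>i. min (k * a i) 1)"
  using assms by (intro bernoulli_set_subset) (auto simp: zero_outside)

lemma includes_support:
  assumes "1 \<le> l" "r \<le> n" "0 < k"
  shows "includes_independently (bernoulli_set {l..r} (\<lambda>i. min (k * a i) 1)) {l..r} (\<lambda>i. min (k * a i) 1)"
  using assms a_nonneg by (intro includes_independently_bernoulli_set) auto

lemma set_xs_bounds: "{i \<in> set xs. 1 \<le> i \<and> i \<le> n} = set xs"
  using set_xs by auto

lemma log_bounds:
  assumes "1 \<le> n" "y \<le> m"
  shows "1 \<le> log 2 (real n + 1)" "real (depth x y) \<le> 2 * log 2 (real n + 1)"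
    "real (floorlog 2 m) \<le> 2 * log 2 (real n + 1)"
  using log_ge_1[OF assms(1)] floorlog_le_log[OF assms(1)] m_le_n assms(2) by (auto simp: depth_def)

lemma sample_query:
  assumes "ready s" "1 \<le> n" "(\<Sum>i = 1..n. a i) > 0"
  shows "surely (exec w sample_com s) (\<lambda>s' t. ready s' \<and> real t \<le> 14 * log 2 (real n + 1))"
    and "\<exists>D. returns_index (exec w sample_com s) D \<and> set_pmf D \<subseteq> {1..n} \<and>
      (\<forall>i \<in> {1..n}. pmf D i = a i / (\<Sum>j = 1..n. a j))"
proof -
  have total: "range_sum 0 m = (\<Sum>i = 1..n. a i)"
    using range_sum_indices[of m 0] sum_support[of 1 n, unfolded set_xs_bounds] by (simp add: indices_all)
  have m: "0 < m" using total assms(3) by (cases m) (auto simp: range_sum_def)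
  show "surely (exec w sample_com s) (\<lambda>s' t. ready s' \<and> real t \<le> 14 * log 2 (real n + 1))"
  proof (rule surely_mono[OF sample_com_correct(1)[OF assms(1) m]])
    fix s' t assume t: "ready s' \<and> t \<le> 5 * depth 0 m + 4"
    then have "real t \<le> 5 * real (depth 0 m) + 4" by linarith
    then show "ready s' \<and> real t \<le> 14 * log 2 (real n + 1)"
      using t log_bounds(1)[OF assms(2), of m] log_bounds(2)[OF assms(2), of m 0] by linarith
  qed
  have pmf: "pmf (pick 0 m) i = (if i \<in> set xs then a i / (\<Sum>j = 1..n. a j) else 0)" for i
    using pmf_pick[OF m, of i] by (simp add: total indices_all)
  then have "set_pmf (pick 0 m) \<subseteq> {1..n}"
    using set_xs by (auto simp: set_pmf_eq)
  moreover have "pmf (pick 0 m) i = a i / (\<Sum>j = 1..n. a j)" if "i \<in> {1..n}" for i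
    using pmf[of i] zero_outside[OF that] by auto
  ultimately show "\<exists>D. returns_index (exec w sample_com s) D \<and> set_pmf D \<subseteq> {1..n} \<and>
      (\<forall>i \<in> {1..n}. pmf D i = a i / (\<Sum>j = 1..n. a j))"
    using sample_com_correct(2)[OF assms(1) m] unfolding returns_index_iff by blast
qed

lemma subset_query:
  assumes "ready s" "1 \<le> n" "0 < k" "rreg s 0 = k"
  shows "surely (exec w subset_com s) (\<lambda>s' t. ready s')"
    and "expected_time (exec w subset_com s) (78 * (1 + k * (\<Sum>i = 1..n. a i)) * log 2 (real n + 1))"
    and "\<exists>D. returns_set (exec w subset_com s) D \<and> includes_independently D {1..n} (\<lambda>i. min (k * a i) 1)"
proof -
  define s1 where "s1 = s\<lparr>wreg := (wreg s)(7 := 0, 8 := wreg s 2)\<rparr>"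
  have s1: "ready s1" "wreg s1 7 = 0" "wreg s1 8 = m" "rreg s1 0 = k"
    using assms by (auto simp: s1_def) (auto simp: ready_def)
  have eq: "exec w subset_com s = map_spmf (\<lambda>(s', t). (s', 2 + t)) (exec w visit s1)"
    unfolding subset_com_def exec_start_range s1_def ..
  have total: "range_sum 0 m = (\<Sum>i = 1..n. a i)"
    using range_sum_indices[of m 0] sum_support[of 1 n, unfolded set_xs_bounds] by (simp add: indices_all)
  have S: "0 \<le> k * (\<Sum>i = 1..n. a i)"
    using assms(3) a_nonneg by (auto intro!: mult_nonneg_nonneg sum_nonneg)
  note visit = visit_surely[OF assms(3) s1(4,1-3)] visit_outcome[OF assms(3) s1(4,1-3)]
    visit_expected_cost[OF assms(3) s1(4,1-3)]
  have surely: "surely (exec w subset_com s) (\<lambda>s' t. ready s' \<and> distinct (out_array s'))"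
    unfolding eq using visit(1) by (intro surely_map) simp
  then show "surely (exec w subset_com s) (\<lambda>s' t. ready s')"
    by (rule surely_mono) simp
  have lossless: "lossless_spmf (exec w visit s1)" using visit(1) by (simp add: surely_def)
  have "expected_cost (exec w subset_com s) (\<lambda>_. 0) = of_nat 2 + expected_cost (exec w visit s1) (\<lambda>_. 0)"
    unfolding eq by (rule expected_cost_map[OF lossless])
  also have "\<dots> \<le> 2 + ennreal (14 + 26 * (k * range_sum 0 m) * (1 + depth 0 m))"
    using visit(3) by (intro add_mono) auto
  also have "\<dots> = ennreal (16 + 26 * (k * range_sum 0 m) * (1 + depth 0 m))"
    using S by (subst ennreal_numeral[symmetric], subst ennreal_plus[symmetric]) (auto simp: total)
  also have "\<dots> \<le> ennreal (78 * (1 + k * (\<Sum>i = 1..n. a i)) * log 2 (real n + 1))"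
  proof (rule ennreal_leI)
    let ?L = "log 2 (real n + 1)" and ?S = "k * (\<Sum>i = 1..n. a i)"
    have "26 * ?S * (1 + depth 0 m) \<le> 78 * ?S * ?L" "1 \<le> ?L"
      using mult_depth_le[OF S log_bounds(1)[OF assms(2), of m] log_bounds(2)[OF assms(2), of m 0]]
        log_bounds(1)[OF assms(2), of m] by auto
    moreover have "78 * (1 + ?S) * ?L = 78 * ?L + 78 * ?S * ?L" by (simp add: algebra_simps)
    ultimately show "16 + 26 * (k * range_sum 0 m) * (1 + depth 0 m) \<le> 78 * (1 + ?S) * ?L"
      unfolding total by linarith
  qed
  finally show "expected_time (exec w subset_com s) (78 * (1 + k * (\<Sum>i = 1..n. a i)) * log 2 (real n + 1))"
    unfolding expected_time_iff using surely by (simp add: surely_def)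
  have "outcome (exec w subset_com s) (\<lambda>s. return_pmf (set (out_array s))) =
      spmf_of_pmf (bernoulli_set {1..n} (\<lambda>i. min (k * a i) 1))"
    unfolding eq outcome_map using visit(2) bernoulli_set_support[of 1 n k, unfolded set_xs_bounds]
    by (simp add: indices_all)
  then have "returns_set (exec w subset_com s) (bernoulli_set {1..n} (\<lambda>i. min (k * a i) 1))"
    unfolding returns_set_iff using surely by (auto simp: surely_def)
  then show "\<exists>D. returns_set (exec w subset_com s) D \<and> includes_independently D {1..n} (\<lambda>i. min (k * a i) 1)"
    using includes_support[of 1 n k] assms(3) by auto
qed

lemma searchingD:
  assumes "ready s0" "searching s0 v s"
  shows "ready s" "rreg s = rreg s0" "i \<notin> {9, 12, 13} \<Longrightarrow> wreg s i = wreg s0 i" "wreg s 12 \<le> m"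
proof -
  have s: "s = s0\<lparr>wreg := wreg s\<rparr>" and w: "\<And>i. i \<notin> {9, 12, 13} \<Longrightarrow> wreg s i = wreg s0 i"
    using assms(2) by (auto simp: searching_def)
  have "ready (s0\<lparr>wreg := wreg s\<rparr>)" using assms(1) by (rule ready_wreg) (use w in auto)
  then show "ready s" using s by simp
  show "rreg s = rreg s0" by (subst s) simp
qed (use assms in \<open>auto simp: searching_def\<close>)

text \<open>Two searches of cost \<open>4 * floorlog 2 m + 3\<close> and three assignments.\<close>

lemma locate_surely:
  assumes "ready s" "wreg s 0 = l" "wreg s 1 = r" "l \<le> r" "r \<le> n"
  shows "surely (exec w locate s) (\<lambda>s' t. t \<le> 8 * floorlog 2 m + 9 \<and> ready s' \<and> rreg s' 0 = rreg s 0 \<and>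
     wreg s' 7 \<le> wreg s' 8 \<and> wreg s' 8 \<le> m \<and>
     indices (wreg s' 7) (wreg s' 8) = {i \<in> set xs. l \<le> i \<and> i \<le> r})"
  unfolding locate_def
proof (rule surely_Seq[OF search_surely[OF assms(1)]])
  fix s1 t1
  assume s1: "searching s (wreg s 0) s1 \<and> wreg s1 13 = wreg s1 12 \<and> t1 \<le> 4 * floorlog 2 m + 3"
  define x where "x = wreg s1 12"
  note S1 = searchingD[OF assms(1) conjunct1[OF s1]]
  define s2 where "s2 = s1\<lparr>wreg := (wreg s1)(7 := x, 1 := r + 1)\<rparr>"
  have s2: "ready s2" "wreg s2 7 = x" "wreg s2 1 = r + 1" "rreg s2 0 = rreg s 0"
    using S1 by (auto simp: s2_def)
  have x: "\<forall>j < x. xs ! j < l" "\<forall>j. x \<le> j \<and> j < m \<longrightarrow> l \<le> xs ! j" "x \<le> m"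
    using s1 assms(2) by (auto simp: searching_def x_def)
  have "r + 1 < 2 ^ w" using assms(5) word_size by simp
  then have eq: "exec w (WAssign 7 (WReg 12) ;; WAssign 1 (WAdd (WReg 1) (WConst 1)) ;; c) s1 =
      map_spmf (\<lambda>(s', t). (s', 2 + t)) (exec w c s2)" for c
    using S1(3)[of 1] assms(3) by (simp add: s2_def x_def map_spmf_conv_bind_spmf case_prod_unfold)
  have "surely (exec w (search 1 ;; WAssign 8 (WReg 12)) s2)
     (\<lambda>s' t. t \<le> 4 * floorlog 2 m + 4 \<and> ready s' \<and> rreg s' 0 = rreg s 0 \<and>
     wreg s' 7 \<le> wreg s' 8 \<and> wreg s' 8 \<le> m \<and>
     indices (wreg s' 7) (wreg s' 8) = {i \<in> set xs. l \<le> i \<and> i \<le> r})"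
  proof (rule surely_Seq[OF search_surely[OF s2(1)]])
    fix s3 t3
    assume s3: "searching s2 (wreg s2 1) s3 \<and> wreg s3 13 = wreg s3 12 \<and> t3 \<le> 4 * floorlog 2 m + 3"
    define y where "y = wreg s3 12"
    note S3 = searchingD[OF s2(1) conjunct1[OF s3]]
    have y: "\<forall>j < y. xs ! j \<le> r" "\<forall>j. y \<le> j \<and> j < m \<longrightarrow> r < xs ! j" "y \<le> m"
      using s3 s2(3) by (auto simp: searching_def y_def less_Suc_eq_le Suc_le_eq)
    have xy: "x \<le> y"
    proof (rule ccontr)
      assume "\<not> x \<le> y"
      then have "xs ! y < l" "r < xs ! y" using x y by auto
      then show False using assms(4) by simp
    qed
    have "indices x y = {i \<in> set xs. l \<le> i \<and> i \<le> r}"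
    proof (intro equalityI subsetI)
      fix i assume "i \<in> indices x y"
      then show "i \<in> {i \<in> set xs. l \<le> i \<and> i \<le> r}"
        using x y length_xs by (auto simp: indices_def)
    next
      fix i assume "i \<in> {i \<in> set xs. l \<le> i \<and> i \<le> r}"
      then obtain j where j: "j < m" "xs ! j = i" "l \<le> i" "i \<le> r"
        using length_xs by (auto simp: in_set_conv_nth)
      then have "x \<le> j" "j < y" using x(1) y(2) by (auto simp: not_less[symmetric] dest: leD)
      then show "i \<in> indices x y" using j by (auto simp: indices_def)
    qed
    moreover have "wreg s3 7 = x" using S3(3)[of 7] s2(2) by simp
    ultimately show "surely (exec w (WAssign 8 (WReg 12)) s3)
      (\<lambda>s' t. t3 + t \<le> 4 * floorlog 2 m + 4 \<and> ready s' \<and> rreg s' 0 = rreg s 0 \<and>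
       wreg s' 7 \<le> wreg s' 8 \<and> wreg s' 8 \<le> m \<and>
       indices (wreg s' 7) (wreg s' 8) = {i \<in> set xs. l \<le> i \<and> i \<le> r})"
      using s3 S3(1,2) s2(4) xy y(3) by (simp add: y_def)
  qed simp
  then show "surely (exec w (WAssign 7 (WReg 12) ;; WAssign 1 (WAdd (WReg 1) (WConst 1)) ;;
     search 1 ;; WAssign 8 (WReg 12)) s1)
    (\<lambda>s' t. t1 + t \<le> 8 * floorlog 2 m + 9 \<and> ready s' \<and> rreg s' 0 = rreg s 0 \<and>
     wreg s' 7 \<le> wreg s' 8 \<and> wreg s' 8 \<le> m \<and>
     indices (wreg s' 7) (wreg s' 8) = {i \<in> set xs. l \<le> i \<and> i \<le> r})"
    unfolding eq using s1 by (intro surely_map) (auto elim!: surely_mono)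
qed simp

lemma interval_query:
  assumes "ready s" "1 \<le> n" "0 < k" "rreg s 0 = k" "wreg s 0 = l" "wreg s 1 = r" "1 \<le> l" "l \<le> r" "r \<le> n"
  shows "surely (exec w interval_com s) (\<lambda>s' t. ready s')"
    and "expected_time (exec w interval_com s) (78 * (1 + k * (\<Sum>i = l..r. a i)) * log 2 (real n + 1) ^ 2)"
    and "\<exists>D. returns_set (exec w interval_com s) D \<and> includes_independently D {l..r} (\<lambda>i. min (k * a i) 1)"
proof -
  note locate = locate_surely[OF assms(1,5,6,8,9)]
  have surely: "surely (exec w interval_com s) (\<lambda>s' t. ready s' \<and> distinct (out_array s'))"
    unfolding interval_com_def
    by (rule surely_Seq[OF locate], rule visit_surely[OF assms(3) _ _ refl refl]) (use assms(4) in auto)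
  then show "surely (exec w interval_com s) (\<lambda>s' t. ready s')"
    by (rule surely_mono) simp
  have "outcome (exec w interval_com s) (\<lambda>s. return_pmf (set (out_array s))) =
      outcome (exec w locate s) (\<lambda>_. bernoulli_set {i \<in> set xs. l \<le> i \<and> i \<le> r} (\<lambda>i. min (k * a i) 1))"
    unfolding interval_com_def
  proof (rule outcome_Seq[OF locate])
    fix s1 t1
    assume "t1 \<le> 8 * floorlog 2 m + 9 \<and> ready s1 \<and> rreg s1 0 = rreg s 0 \<and>
     wreg s1 7 \<le> wreg s1 8 \<and> wreg s1 8 \<le> m \<and>
     indices (wreg s1 7) (wreg s1 8) = {i \<in> set xs. l \<le> i \<and> i \<le> r}"
    then show "outcome (exec w visit s1) (\<lambda>s. return_pmf (set (out_array s))) =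
      spmf_of_pmf (bernoulli_set {i \<in> set xs. l \<le> i \<and> i \<le> r} (\<lambda>i. min (k * a i) 1))"
      using visit_outcome[OF assms(3), of s1 "wreg s1 7" "wreg s1 8"] assms(4) by simp
  qed
  also have "\<dots> = spmf_of_pmf (bernoulli_set {l..r} (\<lambda>i. min (k * a i) 1))"
    using locate bernoulli_set_support[OF assms(7,9)] by (simp add: outcome_const surely_def)
  finally have "returns_set (exec w interval_com s) (bernoulli_set {l..r} (\<lambda>i. min (k * a i) 1))"
    unfolding returns_set_iff using surely by (auto simp: surely_def)
  then show "\<exists>D. returns_set (exec w interval_com s) D \<and> includes_independently D {l..r} (\<lambda>i. min (k * a i) 1)"
    using includes_support[OF assms(7,9,3)] by auto
  let ?L = "log 2 (real n + 1)" and ?S = "\<Sum>i = l..r. a i"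
  have L: "1 \<le> ?L" "real (floorlog 2 m) \<le> 2 * ?L" using log_bounds[OF assms(2)] by auto
  have S: "0 \<le> k * ?S"
    using assms(3,7,9) a_nonneg by (auto intro!: mult_nonneg_nonneg sum_nonneg)
  have "expected_cost (exec w interval_com s) (\<lambda>_. 0) \<le>
      expected_cost (exec w locate s) (\<lambda>_. ennreal (14 + 78 * (k * ?S) * ?L))"
    unfolding interval_com_def
  proof (rule expected_cost_Seq[OF locate], intro conjI)
    fix s1 t1
    assume s1: "t1 \<le> 8 * floorlog 2 m + 9 \<and> ready s1 \<and> rreg s1 0 = rreg s 0 \<and>
     wreg s1 7 \<le> wreg s1 8 \<and> wreg s1 8 \<le> m \<and>
     indices (wreg s1 7) (wreg s1 8) = {i \<in> set xs. l \<le> i \<and> i \<le> r}"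
    then have r: "rreg s1 0 = k" "ready s1" "wreg s1 7 \<le> wreg s1 8" "wreg s1 8 \<le> m"
      using assms(4) by auto
    have sum: "range_sum (wreg s1 7) (wreg s1 8) = ?S"
      using s1 range_sum_indices[OF r(4)] sum_support[OF assms(7,9)] by simp
    show "lossless_spmf (exec w visit s1)"
      using visit_surely[OF assms(3) r(1,2) refl refl r(3,4)] by (simp add: surely_def)
    show "expected_cost (exec w visit s1) (\<lambda>_. 0) \<le> ennreal (14 + 78 * (k * ?S) * ?L)"
      using visit_expected_cost[OF assms(3) r(1,2) refl refl r(3,4)] unfolding sum
      by (rule order_trans) (use mult_depth_le[OF S L(1) log_bounds(2)[OF assms(2) r(4), of "wreg s1 7"]]
        in \<open>intro ennreal_leI add_left_mono, simp\<close>)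
  qed
  also have "\<dots> \<le> of_nat (8 * floorlog 2 m + 9) + ennreal (14 + 78 * (k * ?S) * ?L)"
    by (rule expected_cost_le, rule surely_mono[OF locate]) simp
  also have "\<dots> = ennreal (8 * floorlog 2 m + 9 + (14 + 78 * (k * ?S) * ?L))"
    using S L by (subst ennreal_plus) (auto simp: ennreal_of_nat_eq_real_of_nat)
  also have "\<dots> \<le> ennreal (78 * (1 + k * ?S) * ?L ^ 2)"
  proof (rule ennreal_leI)
    have "78 * (1 + k * ?S) * ?L * 1 = 78 * ?L + 78 * (k * ?S) * ?L"
      by (simp add: algebra_simps)
    then have "8 * floorlog 2 m + 9 + (14 + 78 * (k * ?S) * ?L) \<le> 78 * (1 + k * ?S) * ?L * 1"
      using L by linarith
    \<comment> \<open>Search and visit together take a single logarithm; \<open>1 \<le> ?L\<close>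
      supplies the second factor.\<close>
    also have "\<dots> \<le> 78 * (1 + k * ?S) * ?L * ?L"
      using L S by (intro mult_left_mono) auto
    finally show "8 * floorlog 2 m + 9 + (14 + 78 * (k * ?S) * ?L) \<le> 78 * (1 + k * ?S) * ?L ^ 2"
      by (simp add: power2_eq_square)
  qed
  finally show "expected_time (exec w interval_com s) (78 * (1 + k * (\<Sum>i = l..r. a i)) * log 2 (real n + 1) ^ 2)"
    unfolding expected_time_iff using surely by (simp add: surely_def)
qed

end

section \<open>Preprocessing\<close>

definition scan_step :: "bexp \<Rightarrow> com" where
  "scan_step b =
     If b
       (WStore (WReg 6) (WLoad (WReg 7)) ;; RStore (WReg 6) (RLoad (WReg 7)) ;;
        WAssign 6 (WAdd (WReg 6) (WConst 1)))
       Skip ;;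
     WAssign 7 (WAdd (WReg 7) (WConst 1))"

definition scan :: "bexp \<Rightarrow> com" where
  "scan b = WAssign 7 (WConst 0) ;; While (WLess (WReg 7) (WReg 2)) (scan_step b)"

definition copy_step :: com where
  "copy_step =
     WStore (WReg 7) (WLoad (WAdd (WReg 2) (WReg 7))) ;;
     RStore (WReg 7) (RLoad (WAdd (WReg 2) (WReg 7))) ;;
     WAssign 7 (WAdd (WReg 7) (WConst 1))"

definition copy_back :: com where
  "copy_back = WAssign 7 (WConst 0) ;; While (WLess (WReg 7) (WReg 2)) copy_step"

definition current_bit :: wexp where
  "current_bit = WMod (WDiv (WLoad (WReg 7)) (WReg 5)) (WConst 2)"

text \<open>The two scans append to the same buffer, first the indices whose current bit is 0, then
  the others. Each keeps the given order, which is the stability that radix sort depends on.\<close>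

definition radix_pass :: com where
  "radix_pass =
     WAssign 6 (WReg 2) ;; scan (WLess current_bit (WConst 1)) ;; scan (WLess (WConst 0) current_bit) ;;
     copy_back ;; WAssign 5 (WAdd (WReg 5) (WReg 5))"

definition radix_sort :: com where
  "radix_sort = WAssign 5 (WConst 1) ;; While (BNot (WLess (WReg 0) (WReg 5))) radix_pass"

definition prefix_step :: com where
  "prefix_step =
     RStore (WAdd (WAdd (WReg 2) (WReg 7)) (WConst 1)) (RAdd (RLoad (WAdd (WReg 2) (WReg 7))) (RLoad (WReg 7))) ;;
     WAssign 7 (WAdd (WReg 7) (WConst 1))"

definition prefix_sums :: com where
  "prefix_sums =
     RStore (WReg 2) (RCast (WConst 0)) ;; WAssign 7 (WConst 0) ;;
     While (WLess (WReg 7) (WReg 2)) prefix_step"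

definition prep_com :: com where
  "prep_com =
     WAssign 2 (WReg 1) ;; WAssign 3 (WMul (WConst 2) (WReg 1)) ;; WAssign 4 (WMul (WConst 3) (WReg 1)) ;;
     radix_sort ;; prefix_sums"

text \<open>\<open>i mod (p + p)\<close> is \<open>i mod p\<close>, increased by \<open>p\<close> if
  the bit \<open>i div p mod 2\<close> is set. Inside a block of equal bits the old order is the
  right one, and between the blocks the bit decides.\<close>

lemma sorted_mod_double:
  fixes p :: nat
  assumes "sorted_wrt (\<lambda>i j. i mod p \<le> j mod p) L"
  shows "sorted_wrt (\<lambda>i j. i mod (p + p) \<le> j mod (p + p))
    (filter (\<lambda>i. even (i div p)) L @ filter (\<lambda>i. odd (i div p)) L)"
proof -
  have mod: "i mod (p + p) = p * (i div p mod 2) + i mod p" for i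
    using mod_mult2_eq[of i p 2] by (simp add: mult_2_right)
  have "sorted_wrt (\<lambda>i j. i mod (p + p) \<le> j mod (p + p)) (filter (\<lambda>i. i div p mod 2 = b) L)" for b
    using sorted_wrt_filter[OF assms, of "\<lambda>i. i div p mod 2 = b"]
    by (rule sorted_wrt_mono_rel[rotated]) (auto simp: mod)
  from this[of 0] this[of 1] show ?thesis
    \<comment> \<open>For \<open>p = 0\<close> the quotients vanish and the second block is empty;
      otherwise \<open>i mod p < p\<close> separates the blocks.\<close>
    by (cases "p = 0") (auto simp: sorted_wrt_append even_iff_mod_2_eq_zero odd_iff_mod_2_eq_one mod
        intro: order_trans[OF less_imp_le[OF mod_less_divisor]])
qed

text \<open>The bound on \<open>2 * n + 1\<close> keeps the power of two from wrapping when it is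
  doubled for the last time, from a value of at most \<open>n\<close>.\<close>

locale word_bounds =
  fixes w n m :: nat and a :: "nat \<Rightarrow> real"
  assumes bounds: "4 * m + 2 < 2 ^ w" "2 * n + 1 < 2 ^ w" "1 \<le> n"
begin

lemma word_pos [simp]: "0 < w"
  using bounds by (cases w) auto

definition configured :: "state \<Rightarrow> bool" where
  "configured s \<longleftrightarrow> wreg s 0 = n \<and> wreg s 2 = m \<and> wreg s 3 = 2 * m \<and> wreg s 4 = 3 * m"

definition holds :: "state \<Rightarrow> nat \<Rightarrow> nat list \<Rightarrow> bool" where
  "holds s q L \<longleftrightarrow> (\<forall>j < length L. wmem s (q + j) = L ! j \<and> rmem s (q + j) = a (L ! j))"

definition scanning :: "nat \<Rightarrow> nat list \<Rightarrow> nat list \<Rightarrow> state \<Rightarrow> bool" where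
  "scanning p L U s \<longleftrightarrow> configured s \<and> wreg s 5 = p \<and> holds s 0 L \<and> holds s m U \<and> wreg s 6 = m + length U"

lemma holds_snoc:
  assumes "holds s q U"
  shows "holds (s\<lparr>wmem := (wmem s)(q + length U := i), rmem := (rmem s)(q + length U := a i)\<rparr>) q (U @ [i])"
  using assms by (auto simp: holds_def nth_append less_Suc_eq)

text \<open>The bound on the lengths keeps the buffer inside its block of length \<open>m\<close>;
  the test may depend only on the current entry and the current power of two.\<close>

lemma scan_step_surely:
  assumes b: "\<And>s. wreg s 5 = p \<Longrightarrow> bval w b s \<longleftrightarrow> Q (wmem s (wreg s 7))"
    and s: "scanning p L (U @ filter Q (take j L)) s" "wreg s 7 = j" "j < m"
    and L: "length L = m" "length U + length (filter Q L) \<le> m"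
  shows "surely (exec w (scan_step b) s)
    (\<lambda>s' t. scanning p L (U @ filter Q (take (Suc j) L)) s' \<and> wreg s' 7 = Suc j \<and> t \<le> 5)"
proof -
  have i: "wmem s j = L ! j" "rmem s j = a (L ! j)"
    using s L by (auto simp: scanning_def holds_def)
  have take: "take (Suc j) L = take j L @ [L ! j]"
    using s(3) L(1) by (simp add: take_Suc_conv_app_nth)
  have j: "Suc j mod 2 ^ w = Suc j" using s(3) bounds by simp
  show ?thesis
  proof (cases "Q (L ! j)")
    case False
    then show ?thesis
      using s b[of s] i j by (auto simp: scan_step_def take scanning_def configured_def holds_def)
  next
    case True
    define V where "V = U @ filter Q (take j L)"
    have "filter Q L = filter Q (take (Suc j) L) @ filter Q (drop (Suc j) L)"
      by (metis append_take_drop_id filter_append)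
    then have len: "length V < m" using L True by (simp add: V_def take)
    have V: "holds s m V" "holds s 0 L" "wreg s 6 = m + length V" "configured s" "wreg s 5 = p"
      using s(1) by (auto simp: scanning_def V_def)
    have ov: "Suc (m + length V) mod 2 ^ w = Suc (m + length V)" using len bounds by simp
    define s' where "s' = s\<lparr>wmem := (wmem s)(m + length V := L ! j), rmem := (rmem s)(m + length V := a (L ! j)),
        wreg := (wreg s)(6 := Suc (m + length V), 7 := Suc j)\<rparr>"
    have "exec w (scan_step b) s = return_spmf (s', 5)"
      using V b[of s] True i s j ov by (simp add: scan_step_def s'_def)
    moreover have "holds s' m (V @ [L ! j])"
      using holds_snoc[OF V(1), of "L ! j"] by (simp add: s'_def holds_def)
    moreover have "holds s' 0 L"
      using V(2) L(1) by (auto simp: s'_def holds_def)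
    ultimately show ?thesis
      using V True by (simp add: take V_def scanning_def configured_def s'_def)
  qed
qed

lemma scan_surely:
  assumes b: "\<And>s. wreg s 5 = p \<Longrightarrow> bval w b s \<longleftrightarrow> Q (wmem s (wreg s 7))"
    and s: "scanning p L U s"
    and L: "length L = m" "length U + length (filter Q L) \<le> m"
  shows "surely (exec w (scan b) s) (\<lambda>s' t. scanning p L (U @ filter Q L) s' \<and> t \<le> 6 * m + 2)"
proof -
  define I where "I = (\<lambda>s. scanning p L (U @ filter Q (take (wreg s 7) L)) s \<and> wreg s 7 \<le> m)"
  define s1 where "s1 = s\<lparr>wreg := (wreg s)(7 := 0)\<rparr>"
  have s1: "I s1" "wreg s1 7 = 0"
    using s by (auto simp: I_def s1_def scanning_def configured_def holds_def)
  have reg2: "wreg s 2 = m" if "I s" for s using that by (simp add: I_def scanning_def configured_def)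
  have "surely (loop (bval w (WLess (WReg 7) (WReg 2))) (exec w (scan_step b)) s1)
     (\<lambda>s' t. I s' \<and> \<not> bval w (WLess (WReg 7) (WReg 2)) s' \<and> t \<le> (5 + 1) * (m - wreg s1 7) + 1)"
  proof (rule surely_loop[where I = I])
    fix s assume s: "I s" "bval w (WLess (WReg 7) (WReg 2)) s"
    then have j: "wreg s 7 < m" using reg2 by simp
    show "surely (exec w (scan_step b) s) (\<lambda>s' t. I s' \<and> m - wreg s' 7 < m - wreg s 7 \<and> t \<le> 5)"
      by (rule surely_mono[OF scan_step_surely[where Q = Q, OF b _ refl j L]])
         (use s j in \<open>auto simp: I_def\<close>)
  qed (fact s1)
  then have "surely (loop (bval w (WLess (WReg 7) (WReg 2))) (exec w (scan_step b)) s1)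
     (\<lambda>s' t. scanning p L (U @ filter Q L) s' \<and> t \<le> 6 * m + 1)"
    by (rule surely_mono) (use reg2 s1 L in \<open>auto simp: I_def\<close>)
  moreover have "exec w (scan b) s = map_spmf (\<lambda>(s', t). (s', 1 + t))
      (loop (bval w (WLess (WReg 7) (WReg 2))) (exec w (scan_step b)) s1)"
    by (simp add: scan_def s1_def map_spmf_conv_bind_spmf case_prod_unfold)
  ultimately show ?thesis
    by (auto intro!: surely_map elim!: surely_mono)
qed

definition copied :: "nat \<Rightarrow> nat list \<Rightarrow> state \<Rightarrow> bool" where
  "copied p L s \<longleftrightarrow> configured s \<and> wreg s 5 = p \<and> wreg s 7 \<le> m \<and> holds s m L \<and> holds s 0 (take (wreg s 7) L)"

lemma copy_back_surely:
  assumes s: "scanning p L' L s" and L: "length L = m"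
  shows "surely (exec w copy_back s) (\<lambda>s' t. configured s' \<and> wreg s' 5 = p \<and> holds s' 0 L \<and> t \<le> 4 * m + 2)"
proof -
  define s1 where "s1 = s\<lparr>wreg := (wreg s)(7 := 0)\<rparr>"
  have s1: "copied p L s1" "wreg s1 7 = 0"
    using s by (auto simp: copied_def s1_def scanning_def configured_def holds_def)
  have reg2: "wreg s 2 = m" if "copied p L s" for s using that by (simp add: copied_def configured_def)
  have "surely (loop (bval w (WLess (WReg 7) (WReg 2))) (exec w copy_step) s1)
     (\<lambda>s' t. copied p L s' \<and> \<not> bval w (WLess (WReg 7) (WReg 2)) s' \<and> t \<le> (3 + 1) * (m - wreg s1 7) + 1)"
  proof (rule surely_loop[where I = "copied p L"])
    fix s assume s: "copied p L s" "bval w (WLess (WReg 7) (WReg 2)) s"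
    define j where "j = wreg s 7"
    have j: "j < m" using s reg2 by (simp add: j_def)
    have i: "wmem s (m + j) = L ! j" "rmem s (m + j) = a (L ! j)"
      using s j L by (auto simp: copied_def holds_def)
    define s' where "s' = s\<lparr>wmem := (wmem s)(j := L ! j), rmem := (rmem s)(j := a (L ! j)),
        wreg := (wreg s)(7 := Suc j)\<rparr>"
    have "(m + j) mod 2 ^ w = m + j" "Suc j mod 2 ^ w = Suc j" using j bounds by simp_all
    then have "exec w copy_step s = return_spmf (s', 3)"
      using i reg2[OF s(1)] by (simp add: copy_step_def s'_def j_def)
    moreover have "holds s' 0 (take (Suc j) L)"
      using holds_snoc[of s 0 "take j L" "L ! j"] s(1) j L
      by (simp add: copied_def j_def[symmetric] take_Suc_conv_app_nth s'_def) (simp add: holds_def)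
    moreover have "holds s' m L"
      using s(1) j by (auto simp: copied_def holds_def s'_def)
    ultimately show "surely (exec w copy_step s) (\<lambda>s' t. copied p L s' \<and> m - wreg s' 7 < m - wreg s 7 \<and> t \<le> 3)"
      using s(1) j by (simp add: copied_def configured_def s'_def j_def)
  qed (fact s1)
  then have "surely (loop (bval w (WLess (WReg 7) (WReg 2))) (exec w copy_step) s1)
     (\<lambda>s' t. configured s' \<and> wreg s' 5 = p \<and> holds s' 0 L \<and> t \<le> 4 * m + 1)"
    by (rule surely_mono) (use reg2 s1 L in \<open>auto simp: copied_def\<close>)
  moreover have "exec w copy_back s = map_spmf (\<lambda>(s', t). (s', 1 + t))
      (loop (bval w (WLess (WReg 7) (WReg 2))) (exec w copy_step) s1)"
    by (simp add: copy_back_def s1_def map_spmf_conv_bind_spmf case_prod_unfold)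
  ultimately show ?thesis
    by (auto intro!: surely_map elim!: surely_mono)
qed

text \<open>The time is two scans of \<open>6 * m + 2\<close>, a copy of \<open>4 * m + 2\<close>
  and two assignments.\<close>

lemma radix_pass_surely:
  assumes s: "configured s" "wreg s 5 = p" "holds s 0 L" "length L = m" "p \<le> n"
  shows "surely (exec w radix_pass s) (\<lambda>s' t. configured s' \<and> wreg s' 5 = p + p \<and> t \<le> 16 * m + 8 \<and>
     holds s' 0 (filter (\<lambda>i. even (i div p)) L @ filter (\<lambda>i. odd (i div p)) L))"
proof -
  define s1 where "s1 = s\<lparr>wreg := (wreg s)(6 := m)\<rparr>"
  let ?E = "filter (\<lambda>i. even (i div p)) L" and ?O = "filter (\<lambda>i. odd (i div p)) L"
  have len: "length ?E + length ?O = m"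
    using sum_length_filter_compl[of "\<lambda>i. even (i div p)" L] s(4) by simp
  have two: "2 mod 2 ^ w = (2 :: nat)" using bounds by (intro mod_less) simp
  have low: "bval w (WLess current_bit (WConst 1)) s' \<longleftrightarrow> even (wmem s' (wreg s' 7) div p)"
    and high: "bval w (WLess (WConst 0) current_bit) s' \<longleftrightarrow> odd (wmem s' (wreg s' 7) div p)"
    if "wreg s' 5 = p" for s'
    using that by (auto simp: current_bit_def two even_iff_mod_2_eq_zero)
  have s1: "scanning p L [] s1" "exec w (WAssign 6 (WReg 2)) s = return_spmf (s1, 1)"
    using s by (auto simp: scanning_def s1_def configured_def holds_def)
  have dbl: "(p + p) mod 2 ^ w = p + p" using s(5) bounds by simp
  have "surely (exec w (scan (WLess current_bit (WConst 1)) ;; scan (WLess (WConst 0) current_bit) ;;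
     copy_back ;; WAssign 5 (WAdd (WReg 5) (WReg 5))) s1)
     (\<lambda>s' t. configured s' \<and> wreg s' 5 = p + p \<and> 1 + t \<le> 16 * m + 8 \<and> holds s' 0 (?E @ ?O))"
  proof (rule surely_Seq[OF scan_surely[OF low s1(1) s(4)]], simp_all only: append_Nil)
    fix s2 t2 assume s2: "scanning p L ?E s2 \<and> t2 \<le> 6 * m + 2"
    show "surely (exec w (scan (WLess (WConst 0) current_bit) ;; copy_back ;; WAssign 5 (WAdd (WReg 5) (WReg 5))) s2)
     (\<lambda>s' t. configured s' \<and> wreg s' 5 = p + p \<and> 1 + (t2 + t) \<le> 16 * m + 8 \<and> holds s' 0 (?E @ ?O))"
    proof (rule surely_Seq[OF scan_surely[OF high conjunct1[OF s2] s(4)]])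
      fix s3 t3 assume s3: "scanning p L (?E @ ?O) s3 \<and> t3 \<le> 6 * m + 2"
      show "surely (exec w (copy_back ;; WAssign 5 (WAdd (WReg 5) (WReg 5))) s3)
       (\<lambda>s' t. configured s' \<and> wreg s' 5 = p + p \<and> 1 + (t2 + (t3 + t)) \<le> 16 * m + 8 \<and> holds s' 0 (?E @ ?O))"
        by (rule surely_Seq[OF copy_back_surely[OF conjunct1[OF s3]]])
           (use len s2 s3 dbl in \<open>auto simp: configured_def holds_def\<close>)
    qed (use len in simp_all)
  qed (use len in simp_all)
  then show ?thesis
    unfolding radix_pass_def by (intro surely_Seq[of w _ s "\<lambda>s' t. s' = s1 \<and> t = 1"]) (use s1 in auto)
qed

end

context word_bounds
begin

definition sorting :: "nat set \<Rightarrow> state \<Rightarrow> bool" where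
  "sorting S s \<longleftrightarrow> configured s \<and> 1 \<le> wreg s 5 \<and>
     (\<exists>L. holds s 0 L \<and> distinct L \<and> set L = S \<and> length L = m \<and>
        sorted_wrt (\<lambda>i j. i mod wreg s 5 \<le> j mod wreg s 5) L)"

text \<open>The measure \<open>floorlog 2 (n div p)\<close> is the number of bits of
  \<open>n\<close> not yet processed; doubling \<open>p\<close> removes one.\<close>

lemma radix_sort_surely:
  assumes s: "configured s" "holds s 0 L" "distinct L" "set L = S" "length L = m"
    and S: "S \<subseteq> {1..n}"
  shows "surely (exec w radix_sort s) (\<lambda>s' t. configured s' \<and> t \<le> (16 * m + 9) * floorlog 2 n + 2 \<and>
    (\<exists>L'. holds s' 0 L' \<and> set L' = S \<and> length L' = m \<and> sorted_wrt (<) L'))"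
proof -
  let ?b = "BNot (WLess (WReg 0) (WReg 5))"
  define s1 where "s1 = s\<lparr>wreg := (wreg s)(5 := 1)\<rparr>"
  have "sorted_wrt (\<lambda>i j. i mod 1 \<le> j mod 1) L"
    by (auto simp: sorted_wrt_iff_nth_less)
  then have s1: "sorting S s1" "wreg s1 5 = 1"
    using s by (auto simp: sorting_def s1_def configured_def holds_def intro!: exI[of _ L])
  have "surely (loop (bval w ?b) (exec w radix_pass) s1)
     (\<lambda>s' t. sorting S s' \<and> \<not> bval w ?b s' \<and> t \<le> (16 * m + 8 + 1) * floorlog 2 (n div wreg s1 5) + 1)"
  proof (rule surely_loop[where I = "sorting S"])
    fix s assume s: "sorting S s" "bval w ?b s"
    define p where "p = wreg s 5"
    obtain L where L: "configured s" "1 \<le> p" "holds s 0 L" "distinct L" "set L = S" "length L = m"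
      "sorted_wrt (\<lambda>i j. i mod p \<le> j mod p) L"
      using s(1) by (auto simp: sorting_def p_def)
    have p: "p \<le> n" using s(2) L(1) by (simp add: p_def configured_def)
    let ?L = "filter (\<lambda>i. even (i div p)) L @ filter (\<lambda>i. odd (i div p)) L"
    have "0 < n div p" using p L(2) by (simp add: div_greater_zero_iff)
    then have "floorlog 2 (n div p) = floorlog 2 (n div p div 2) + 1"
      by (subst compute_floorlog) simp
    moreover have "n div (p + p) = n div p div 2"
      by (simp add: div_mult2_eq[symmetric] mult_2_right)
    ultimately have log: "floorlog 2 (n div (p + p)) < floorlog 2 (n div p)" by simp
    show "surely (exec w radix_pass s)
      (\<lambda>s' t. sorting S s' \<and> floorlog 2 (n div wreg s' 5) < floorlog 2 (n div wreg s 5) \<and> t \<le> 16 * m + 8)"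
    proof (rule surely_mono[OF radix_pass_surely[OF L(1) p_def[symmetric] L(3,6) p]])
      fix s' t
      assume s': "configured s' \<and> wreg s' 5 = p + p \<and> t \<le> 16 * m + 8 \<and> holds s' 0 ?L"
      have "distinct ?L" "set ?L = S" "length ?L = m"
        using L(4-6) sum_length_filter_compl[of "\<lambda>i. even (i div p)" L] by auto
      then have "sorting S s'"
        using s' L(2) sorted_mod_double[OF L(7)] unfolding sorting_def by (intro conjI exI[of _ ?L]) auto
      then show "sorting S s' \<and> floorlog 2 (n div wreg s' 5) < floorlog 2 (n div wreg s 5) \<and> t \<le> 16 * m + 8"
        using s' log by (simp add: p_def)
    qed
  qed (fact s1)
  then have "surely (loop (bval w ?b) (exec w radix_pass) s1)
     (\<lambda>s' t. configured s' \<and> t \<le> (16 * m + 9) * floorlog 2 n + 1 \<and>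
    (\<exists>L'. holds s' 0 L' \<and> set L' = S \<and> length L' = m \<and> sorted_wrt (<) L'))"
  proof (rule surely_mono)
    fix s' t
    assume s': "sorting S s' \<and> \<not> bval w ?b s' \<and> t \<le> (16 * m + 8 + 1) * floorlog 2 (n div wreg s1 5) + 1"
    then obtain L' where L': "configured s'" "holds s' 0 L'" "distinct L'" "set L' = S" "length L' = m"
        "sorted_wrt (\<lambda>i j. i mod wreg s' 5 \<le> j mod wreg s' 5) L'"
      by (auto simp: sorting_def)
    \<comment> \<open>Once the power of two exceeds \<open>n\<close>, reduction modulo it is the
      identity on the indices, and distinctness turns the order into a strict one.\<close>
    have "n < wreg s' 5" using s' L'(1) by (simp add: configured_def)
    then have "i mod wreg s' 5 = i" if "i \<in> set L'" for i
      using that L'(4) S by (intro mod_less) auto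
    then have "sorted_wrt (\<le>) L'"
      using L'(6) by (auto simp: sorted_wrt_iff_nth_less)
    then show "configured s' \<and> t \<le> (16 * m + 9) * floorlog 2 n + 1 \<and>
      (\<exists>L'. holds s' 0 L' \<and> set L' = S \<and> length L' = m \<and> sorted_wrt (<) L')"
      using s' L' s1(2) by (auto simp: strict_sorted_iff ac_simps)
  qed
  moreover have "exec w radix_sort s = map_spmf (\<lambda>(s', t). (s', 1 + t)) (loop (bval w ?b) (exec w radix_pass) s1)"
    by (simp add: radix_sort_def s1_def map_spmf_conv_bind_spmf case_prod_unfold)
  ultimately show ?thesis
    by (auto intro!: surely_map elim!: surely_mono)
qed

text \<open>The sums overwrite the buffer of the sort, from address \<open>m\<close> on; the values
  they are computed from lie below \<open>m\<close> and survive.\<close>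

definition summing :: "nat list \<Rightarrow> state \<Rightarrow> bool" where
  "summing L s \<longleftrightarrow> configured s \<and> holds s 0 L \<and> wreg s 7 \<le> m \<and>
     (\<forall>j \<le> wreg s 7. rmem s (m + j) = (\<Sum>i<j. a (L ! i)))"

lemma prefix_sums_surely:
  assumes s: "configured s" "holds s 0 L" "length L = m"
  shows "surely (exec w prefix_sums s) (\<lambda>s' t. configured s' \<and> holds s' 0 L \<and>
    (\<forall>j \<le> m. rmem s' (m + j) = (\<Sum>i<j. a (L ! i))) \<and> t \<le> 3 * m + 3)"
proof -
  define s1 where "s1 = s\<lparr>rmem := (rmem s)(m := 0), wreg := (wreg s)(7 := 0)\<rparr>"
  have s1: "summing L s1" "wreg s1 7 = 0"
    using s by (auto simp: summing_def s1_def configured_def holds_def)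
  have reg2: "wreg s 2 = m" if "summing L s" for s using that by (simp add: summing_def configured_def)
  have "surely (loop (bval w (WLess (WReg 7) (WReg 2))) (exec w prefix_step) s1)
     (\<lambda>s' t. summing L s' \<and> \<not> bval w (WLess (WReg 7) (WReg 2)) s' \<and> t \<le> (2 + 1) * (m - wreg s1 7) + 1)"
  proof (rule surely_loop[where I = "summing L"])
    fix s assume s: "summing L s" "bval w (WLess (WReg 7) (WReg 2)) s"
    define j where "j = wreg s 7"
    have j: "j < m" using s reg2 by (simp add: j_def)
    define s' where "s' = s\<lparr>rmem := (rmem s)(Suc (m + j) := (\<Sum>i<Suc j. a (L ! i))), wreg := (wreg s)(7 := Suc j)\<rparr>"
    have "rmem s (m + j) = (\<Sum>i<j. a (L ! i))" "rmem s j = a (L ! j)"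
      using s(1) j assms(3) by (auto simp: summing_def holds_def j_def)
    moreover have "(m + j) mod 2 ^ w = m + j" "Suc (m + j) mod 2 ^ w = Suc (m + j)" "Suc j mod 2 ^ w = Suc j"
      using j bounds by simp_all
    ultimately have "exec w prefix_step s = return_spmf (s', 2)"
      using reg2[OF s(1)] by (simp add: prefix_step_def s'_def j_def)
    moreover have "summing L s'"
      using s(1) j assms(3) by (auto simp: summing_def s'_def configured_def holds_def j_def le_Suc_eq)
    ultimately show "surely (exec w prefix_step s) (\<lambda>s' t. summing L s' \<and> m - wreg s' 7 < m - wreg s 7 \<and> t \<le> 2)"
      using j by (simp add: s'_def j_def)
  qed (fact s1)
  then have "surely (loop (bval w (WLess (WReg 7) (WReg 2))) (exec w prefix_step) s1)
     (\<lambda>s' t. configured s' \<and> holds s' 0 L \<and> (\<forall>j \<le> m. rmem s' (m + j) = (\<Sum>i<j. a (L ! i))) \<and> t \<le> 3 * m + 1)"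
    by (rule surely_mono) (use reg2 s1 in \<open>auto simp: summing_def\<close>)
  moreover have "exec w prefix_sums s = map_spmf (\<lambda>(s', t). (s', 2 + t))
      (loop (bval w (WLess (WReg 7) (WReg 2))) (exec w prefix_step) s1)"
    using s(1) by (simp add: prefix_sums_def s1_def configured_def map_spmf_conv_bind_spmf case_prod_unfold)
  ultimately show ?thesis
    by (auto intro!: surely_map elim!: surely_mono)
qed

lemma prep_com_surely:
  assumes s: "wreg s 0 = n" "wreg s 1 = m" "holds s 0 L" "distinct L" "length L = m"
    and L: "set L = {i \<in> {1..n}. a i > 0}" and a: "\<And>i. i \<in> {1..n} \<Longrightarrow> 0 \<le> a i"
  shows "surely (exec w prep_com s) (\<lambda>s' t. t \<le> (16 * m + 9) * floorlog 2 n + 3 * m + 8 \<and>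
    (\<exists>xs. sorted_support w n m a xs \<and> sorted_support.ready m a xs s'))"
proof -
  define s1 where "s1 = s\<lparr>wreg := (wreg s)(2 := m, 3 := 2 * m, 4 := 3 * m)\<rparr>"
  have s1: "configured s1" "holds s1 0 L"
    using s by (auto simp: s1_def configured_def holds_def)
  \<comment> \<open>For \<open>m = 0\<close> both products vanish, whatever their constant factor is
    modulo \<open>2 ^ w\<close>.\<close>
  have "2 mod 2 ^ w = (2 :: nat)" "3 mod 2 ^ w = (3 :: nat)" "2 * m mod 2 ^ w = 2 * m" "3 * m mod 2 ^ w = 3 * m"
    if "0 < m" using bounds that by simp_all
  then have eq: "exec w prep_com s = map_spmf (\<lambda>(s', t). (s', 3 + t)) (exec w (radix_sort ;; prefix_sums) s1)"
    using s(2) by (cases "m = 0") (auto simp: prep_com_def s1_def map_spmf_conv_bind_spmf case_prod_unfold numeral_eq_Suc)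
  have "surely (exec w (radix_sort ;; prefix_sums) s1)
     (\<lambda>s' t. t \<le> (16 * m + 9) * floorlog 2 n + 3 * m + 5 \<and>
      (\<exists>xs. sorted_support w n m a xs \<and> sorted_support.ready m a xs s'))"
  proof (rule surely_Seq[OF radix_sort_surely[OF s1 s(4) L s(5)]])
    fix s2 t2
    assume s2: "configured s2 \<and> t2 \<le> (16 * m + 9) * floorlog 2 n + 2 \<and>
      (\<exists>xs. holds s2 0 xs \<and> set xs = {i \<in> {1..n}. 0 < a i} \<and> length xs = m \<and> sorted_wrt (<) xs)"
    then obtain xs where xs: "holds s2 0 xs" "set xs = {i \<in> {1..n}. 0 < a i}" "length xs = m" "sorted_wrt (<) xs"
      by blast
    interpret sorted_support w n m a xs
      using a xs bounds by unfold_locales auto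
    have "ready s'" if "configured s'" "holds s' 0 xs" "\<forall>j \<le> m. rmem s' (m + j) = (\<Sum>i<j. a (xs ! i))" for s'
      using that xs(3) by (auto simp: ready_def configured_def holds_def range_sum_def atLeast0LessThan)
    then show "surely (exec w prefix_sums s2)
     (\<lambda>s' t. t2 + t \<le> (16 * m + 9) * floorlog 2 n + 3 * m + 5 \<and>
      (\<exists>xs. sorted_support w n m a xs \<and> sorted_support.ready m a xs s'))"
      using s2 sorted_support_axioms
      by (intro surely_mono[OF prefix_sums_surely[OF conjunct1[OF s2] xs(1,3)]]) auto
  qed auto
  then show ?thesis
    unfolding eq by (intro surely_map) (auto elim!: surely_mono)
qed

end

section \<open>Assembly of the data structure\<close>

lemma worst_case_time_iff: "worst_case_time M B \<longleftrightarrow> surely M (\<lambda>s t. real t \<le> B)"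
  by (auto simp: worst_case_time_def surely_def)

definition range_structure :: data_structure where
  "range_structure = \<lparr>prep = prep_com, sample_prog = sample_com, subset_prog = subset_com,
     interval_prog = interval_com\<rparr>"

text \<open>The maximum with 1 accounts for an empty support, for which the sort still runs one pass
  per bit of \<open>n\<close>.\<close>

lemma prep_time_le:
  assumes "1 \<le> n" "m \<le> n"
  shows "real ((16 * m + 9) * floorlog 2 n + 3 * m + 8) \<le> 78 * max 1 (real m) * log 2 (real n + 1)"
proof -
  let ?M = "max 1 (real m)" and ?L = "log 2 (real n + 1)"
  have L: "1 \<le> ?L" "real (floorlog 2 n) \<le> 2 * ?L"
    using log_ge_1[OF assms(1)] floorlog_le_log[OF assms(1), of n] by auto
  have "real ((16 * m + 9) * floorlog 2 n + 3 * m + 8) = (16 * real m + 9) * real (floorlog 2 n) + (3 * real m + 8) * 1"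
    by simp
  also have "\<dots> \<le> (25 * ?M) * (2 * ?L) + (11 * ?M) * ?L"
    using L by (intro add_mono mult_mono) auto
  also have "\<dots> = 61 * (?M * ?L)" by simp
  also have "\<dots> \<le> 78 * (?M * ?L)" using L by (intro mult_right_mono) auto
  finally show ?thesis by (simp add: mult.assoc)
qed

lemma (in sorted_support) ready_reachable:
  assumes "1 \<le> n" and init: "\<And>s t. (s, t) \<in> set_spmf (exec w prep_com s0) \<Longrightarrow> ready s"
    and "s \<in> reachable w range_structure n a s0"
  shows "ready s"
  using assms(3)
proof (induction rule: reachable.induct)
  case (init s t)
  then show ?case using assms(2) by (simp add: range_structure_def)
next
  case (query s q s' t)
  show ?case
  proof (cases q)
    case Sample
    then show ?thesis
      using query sample_query(1)[OF query.IH assms(1)] by (auto simp: surely_def range_structure_def)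
  next
    case (Subset k)
    let ?s = "s\<lparr>rreg := (rreg s)(0 := k)\<rparr>"
    have "surely (exec w subset_com ?s) (\<lambda>s' t. ready s')"
      using query Subset assms(1) by (intro subset_query(1)[where k = k]) auto
    then show ?thesis using query Subset by (auto simp: surely_def range_structure_def)
  next
    case (Interval l r k)
    let ?s = "s\<lparr>wreg := (wreg s)(0 := l, 1 := r), rreg := (rreg s)(0 := k)\<rparr>"
    have "ready ?s" using query.IH by simp
    then have "surely (exec w interval_com ?s) (\<lambda>s' t. ready s')"
      using query Interval assms(1) by (intro interval_query(1)[where k = k and l = l and r = r]) auto
    then show ?thesis using query Interval by (auto simp: surely_def range_structure_def)
  qed
qed

lemma (in sorted_support) queries_correct:
  assumes "ready s" "1 \<le> n"
  shows "valid_query n a Sample \<longrightarrow>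
      worst_case_time (run_query w range_structure Sample s) (78 * log 2 (real n + 1)) \<and>
      (\<exists>D. returns_index (run_query w range_structure Sample s) D \<and> set_pmf D \<subseteq> {1..n} \<and>
        (\<forall>i \<in> {1..n}. pmf D i = a i / (\<Sum>j = 1..n. a j)))"
    and "valid_query n a (Subset k) \<longrightarrow>
      expected_time (run_query w range_structure (Subset k) s)
        (78 * (1 + k * (\<Sum>i = 1..n. a i)) * log 2 (real n + 1)) \<and>
      (\<exists>D. returns_set (run_query w range_structure (Subset k) s) D \<and>
        includes_independently D {1..n} (\<lambda>i. min (k * a i) 1))"
    and "valid_query n a (Interval l r k) \<longrightarrow>
      expected_time (run_query w range_structure (Interval l r k) s)
        (78 * (1 + k * (\<Sum>i = l..r. a i)) * log 2 (real n + 1) ^ 2) \<and>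
      (\<exists>D. returns_set (run_query w range_structure (Interval l r k) s) D \<and>
        includes_independently D {l..r} (\<lambda>i. min (k * a i) 1))"
proof -
  show "valid_query n a Sample \<longrightarrow>
      worst_case_time (run_query w range_structure Sample s) (78 * log 2 (real n + 1)) \<and>
      (\<exists>D. returns_index (run_query w range_structure Sample s) D \<and> set_pmf D \<subseteq> {1..n} \<and>
        (\<forall>i \<in> {1..n}. pmf D i = a i / (\<Sum>j = 1..n. a j)))"
  proof (intro impI conjI)
    assume "valid_query n a Sample"
    then have pos: "(\<Sum>i = 1..n. a i) > 0" by simp
    show "worst_case_time (run_query w range_structure Sample s) (78 * log 2 (real n + 1))"
      using surely_mono[OF sample_query(1)[OF assms pos]] log_ge_1[OF assms(2)]
      by (auto simp: worst_case_time_iff range_structure_def)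
    show "\<exists>D. returns_index (run_query w range_structure Sample s) D \<and> set_pmf D \<subseteq> {1..n} \<and>
        (\<forall>i \<in> {1..n}. pmf D i = a i / (\<Sum>j = 1..n. a j))"
      using sample_query(2)[OF assms pos] by (simp add: range_structure_def)
  qed
  show "valid_query n a (Subset k) \<longrightarrow>
      expected_time (run_query w range_structure (Subset k) s)
        (78 * (1 + k * (\<Sum>i = 1..n. a i)) * log 2 (real n + 1)) \<and>
      (\<exists>D. returns_set (run_query w range_structure (Subset k) s) D \<and>
        includes_independently D {1..n} (\<lambda>i. min (k * a i) 1))"
    using subset_query(2,3)[of "s\<lparr>rreg := (rreg s)(0 := k)\<rparr>" k] assms
    by (simp add: range_structure_def)
  have "ready (s\<lparr>wreg := (wreg s)(0 := l, 1 := r), rreg := (rreg s)(0 := k)\<rparr>)"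
    using assms(1) by simp
  then show "valid_query n a (Interval l r k) \<longrightarrow>
      expected_time (run_query w range_structure (Interval l r k) s)
        (78 * (1 + k * (\<Sum>i = l..r. a i)) * log 2 (real n + 1) ^ 2) \<and>
      (\<exists>D. returns_set (run_query w range_structure (Interval l r k) s) D \<and>
        includes_independently D {l..r} (\<lambda>i. min (k * a i) 1))"
    using interval_query(2,3)[of "s\<lparr>wreg := (wreg s)(0 := l, 1 := r), rreg := (rreg s)(0 := k)\<rparr>" k l r] assms(2)
    by (auto simp: range_structure_def)
qed

text \<open>The hypothesis says \<open>(n + 1) ^ 4 \<le> 2 ^ w\<close>. Since
  \<open>2 \<le> n + 1\<close>, three of the four factors yield the constant 8.\<close>

lemma word_bounds_if_log:
  assumes "1 \<le> n" "m \<le> n" "real w \<ge> 4 * log 2 (real n + 1)"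
  shows "word_bounds w n m"
proof
  have "8 * (n + 1) = 2 ^ 3 * (n + 1)" by simp
  also have "\<dots> \<le> (n + 1) ^ 3 * (n + 1)"
    using assms(1) by (intro mult_right_mono power_mono) auto
  also have "\<dots> = (n + 1) ^ 4"
    by (simp only: power4_eq_xxxx power3_eq_cube)
  also have "real ((n + 1) ^ 4) = 2 powr (4 * log 2 (real n + 1))"
    using powr_powr[of 2 "log 2 (real n + 1)" 4] by (simp add: mult.commute add.commute)
  also have "\<dots> \<le> 2 powr real w" using assms(3) by (intro powr_mono) auto
  also have "\<dots> = real (2 ^ w)" by (simp add: powr_realpow)
  finally have "8 * (n + 1) \<le> 2 ^ w" by (simp only: of_nat_le_iff)
  then show "4 * m + 2 < 2 ^ w" "2 * n + 1 < 2 ^ w" using assms(2) by simp_all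
qed (fact assms)

theorem theorem7p1:
  shows "\<exists>(P :: data_structure) (c :: real) (d :: nat) (C :: real).
    \<forall>(n :: nat) (w :: nat) (a :: nat \<Rightarrow> real) (s0 :: state).
      n \<ge> 1 \<longrightarrow> (\<forall>i \<in> {1..n}. a i \<ge> 0) \<longrightarrow>
      real w \<ge> c * log 2 (real n + 1) \<longrightarrow> sparse_input w n a s0 \<longrightarrow>
      worst_case_time (exec w (prep P) s0)
        (C * max 1 (real (card {i \<in> {1..n}. a i > 0})) * log 2 (real n + 1) ^ d) \<and>
      (\<forall>s \<in> reachable w P n a s0.
        (valid_query n a Sample \<longrightarrow>
          worst_case_time (run_query w P Sample s) (C * log 2 (real n + 1)) \<and>
          (\<exists>D. returns_index (run_query w P Sample s) D \<and> set_pmf D \<subseteq> {1..n} \<and>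
            (\<forall>i \<in> {1..n}. pmf D i = a i / (\<Sum>j = 1..n. a j)))) \<and>
        (\<forall>k. valid_query n a (Subset k) \<longrightarrow>
          expected_time (run_query w P (Subset k) s)
            (C * (1 + k * (\<Sum>i = 1..n. a i)) * log 2 (real n + 1)) \<and>
          (\<exists>D. returns_set (run_query w P (Subset k) s) D \<and>
            includes_independently D {1..n} (\<lambda>i. min (k * a i) 1))) \<and>
        (\<forall>l r k. valid_query n a (Interval l r k) \<longrightarrow>
          expected_time (run_query w P (Interval l r k) s)
            (C * (1 + k * (\<Sum>i = l..r. a i)) * log 2 (real n + 1) ^ 2) \<and>
          (\<exists>D. returns_set (run_query w P (Interval l r k) s) D \<and>
            includes_independently D {l..r} (\<lambda>i. min (k * a i) 1))))"
proof (rule exI[of _ range_structure], rule exI[of _ 4], rule exI[of _ 1], rule exI[of _ 78], intro allI impI)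
  fix n w :: nat and a :: "nat \<Rightarrow> real" and s0 :: state
  assume n: "1 \<le> n" and a: "\<forall>i \<in> {1..n}. 0 \<le> a i" and w: "real w \<ge> 4 * log 2 (real n + 1)"
    and s0: "sparse_input w n a s0"
  define m where "m = card {i \<in> {1..n}. a i > 0}"
  obtain L where L: "distinct L" "set L = {i \<in> {1..n}. a i > 0}" "wreg s0 1 = length L"
      "\<forall>j < length L. wmem s0 j = L ! j \<and> rmem s0 j = a (L ! j)" and s0n: "wreg s0 0 = n"
    using s0 by (auto simp: sparse_input_def)
  have m: "length L = m" using distinct_card[OF L(1)] by (simp add: m_def L(2))
  have "m \<le> card {1..n}" unfolding m_def by (intro card_mono) auto
  then have mn: "m \<le> n" by simp
  interpret word_bounds w n m a
    using word_bounds_if_log[OF n mn w] .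
  have prep: "surely (exec w prep_com s0) (\<lambda>s' t. t \<le> (16 * m + 9) * floorlog 2 n + 3 * m + 8 \<and>
    (\<exists>xs. sorted_support w n m a xs \<and> sorted_support.ready m a xs s'))"
    by (rule prep_com_surely[of s0 L]) (use L s0n m a in \<open>auto simp: holds_def\<close>)
  have time: "worst_case_time (exec w prep_com s0) (78 * max 1 (real m) * log 2 (real n + 1))"
    unfolding worst_case_time_iff
  proof (rule surely_mono[OF prep])
    fix s t assume "t \<le> (16 * m + 9) * floorlog 2 n + 3 * m + 8 \<and>
      (\<exists>xs. sorted_support w n m a xs \<and> sorted_support.ready m a xs s)"
    then have "real t \<le> real ((16 * m + 9) * floorlog 2 n + 3 * m + 8)" by (simp only: of_nat_le_iff)
    then show "real t \<le> 78 * max 1 (real m) * log 2 (real n + 1)"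
      using prep_time_le[OF n mn] by linarith
  qed
  define xs where "xs = sorted_list_of_set {i \<in> {1..n}. a i > 0}"
  \<comment> \<open>Preprocessing yields a sorted list for each final state separately. A strictly
    sorted list is determined by its set, so one list \<open>xs\<close>, and one interpretation of
    the locale, serves all reachable states.\<close>
  have unique: "L' = xs" if "sorted_support w n m a L'" for L'
  proof -
    interpret sorted_support w n m a L' by (fact that)
    show ?thesis
      using sorted set_xs unfolding xs_def by (metis sorted_list_of_set.idem_if_sorted_distinct strict_sorted_iff)
  qed
  interpret sorted_support w n m a xs
    using a bounds by unfold_locales (auto simp: xs_def m_def)
  have ready: "ready s" if "s \<in> reachable w range_structure n a s0" for s
    by (rule ready_reachable[OF n _ that]) (use prep unique in \<open>fastforce simp: surely_def\<close>)
  show "worst_case_time (exec w (prep range_structure) s0)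
        (78 * max 1 (real (card {i \<in> {1..n}. a i > 0})) * log 2 (real n + 1) ^ 1) \<and>
      (\<forall>s \<in> reachable w range_structure n a s0.
        (valid_query n a Sample \<longrightarrow>
          worst_case_time (run_query w range_structure Sample s) (78 * log 2 (real n + 1)) \<and>
          (\<exists>D. returns_index (run_query w range_structure Sample s) D \<and> set_pmf D \<subseteq> {1..n} \<and>
            (\<forall>i \<in> {1..n}. pmf D i = a i / (\<Sum>j = 1..n. a j)))) \<and>
        (\<forall>k. valid_query n a (Subset k) \<longrightarrow>
          expected_time (run_query w range_structure (Subset k) s)
            (78 * (1 + k * (\<Sum>i = 1..n. a i)) * log 2 (real n + 1)) \<and>
          (\<exists>D. returns_set (run_query w range_structure (Subset k) s) D \<and>
            includes_independently D {1..n} (\<lambda>i. min (k * a i) 1))) \<and>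
        (\<forall>l r k. valid_query n a (Interval l r k) \<longrightarrow>
          expected_time (run_query w range_structure (Interval l r k) s)
            (78 * (1 + k * (\<Sum>i = l..r. a i)) * log 2 (real n + 1) ^ 2) \<and>
          (\<exists>D. returns_set (run_query w range_structure (Interval l r k) s) D \<and>
            includes_independently D {l..r} (\<lambda>i. min (k * a i) 1))))"
  proof (intro conjI ballI allI)
    show "worst_case_time (exec w (prep range_structure) s0)
        (78 * max 1 (real (card {i \<in> {1..n}. a i > 0})) * log 2 (real n + 1) ^ 1)"
      using time by (simp add: m_def range_structure_def)
  qed (rule queries_correct[OF ready n]; assumption)+
qed

end
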